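(* Let $PD(n)$ denote the number of partitions of $n$ with designated summands. Then $$\sum_{n=0}^{\infty} PD(3n+1)q^n = \frac{(q^3;q^6)_\infty^3 (q^6;q^6)_\infty^6}{(q;q^2)_\infty^5 (q^2;q^2)_\infty^8}\left(4q\,\frac{(q;q^2)_\infty^2}{(q^3;q^6)_\infty^6} + \frac{(q^3;q^6)_\infty^3}{(q;q^2)_\infty}\right).$$
   Context: A partition of $n$ with designated summands is an ordinary partition of $n$ in which, for each part size that occurs, exactly one of the parts of that size is designated; if a size $t$ occurs $m_t$ times, the copies are regarded as ordered and the designation may be placed on any one of the $m_t$ positions, different positions giving different objects (e.g. $2'+2$ and $2+2'$ are distinct). $PD(n)$ is the number of such objects, $PD(0)=1$. Notation: $(a;q)_\infty=\prod_{n\ge1}(1-aq^{n-1})$; identities are of formal power series in $q$ (equivalently for $|q|<1$). *)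

theory Defs
  imports "HOL-Analysis.Analysis" "HOL-Library.Multiset" "HOL-Library.FuncSet"
begin

text \<open>
  A partition of \<open>n\<close> is the multiset \<open>M\<close> of its parts. A designation \<open>d\<close> assigns to each part
  size \<open>t\<close> that occurs the position, among the \<open>count M t\<close> ordered copies of \<open>t\<close>, of the
  designated one. Being an element of a dependent function space \<open>PiE\<close>, \<open>d\<close> is
  \<open>undefined\<close> at sizes that do not occur, so no object is counted twice.
\<close>

definition designated_partitions :: "nat \<Rightarrow> (nat multiset \<times> (nat \<Rightarrow> nat)) set" where
  "designated_partitions n =
     {(M, d). 0 \<notin># M \<and> sum_mset M = n \<and> d \<in> (\<Pi>\<^sub>E t\<in>set_mset M. {1..count M t})}"

definition PD :: "nat \<Rightarrow> nat" where
  "PD n = card (designated_partitions n)"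

lemma finite_designated_partitions: "finite (designated_partitions n)"
proof -
  let ?P = "{M. 0 \<notin># M \<and> sum_mset M = n}"
  have "size M \<le> n \<and> set_mset M \<subseteq> {..n}" if "M \<in> ?P" for M
  proof -
    have "size M \<le> sum_mset M" if "0 \<notin># M" for M :: "nat multiset"
      using that by (induction M) (simp_all add: Suc_leI add_mono)
    moreover have "t \<le> sum_mset M" if "t \<in># M" for t
      using that by (auto dest!: multi_member_split)
    ultimately show ?thesis
      using that by auto
  qed
  then have "?P \<subseteq> mset ` {xs. set xs \<subseteq> {..n} \<and> length xs \<le> n}"
  proof -
    assume *: "\<And>M. M \<in> ?P \<Longrightarrow> size M \<le> n \<and> set_mset M \<subseteq> {..n}"
    show ?thesis
    proof
      fix M assume "M \<in> ?P"
      moreover obtain xs where "mset xs = M"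
        using ex_mset by blast
      ultimately show "M \<in> mset ` {xs. set xs \<subseteq> {..n} \<and> length xs \<le> n}"
        using *[of M] by (intro image_eqI[of _ _ xs]) auto
    qed
  qed
  then have "finite ?P"
    by (rule finite_subset) (intro finite_imageI finite_lists_length_le finite_atMost)
  moreover have "designated_partitions n
      = (SIGMA M:?P. (\<Pi>\<^sub>E t\<in>set_mset M. {1..count M t}))"
    by (auto simp: designated_partitions_def)
  ultimately show ?thesis
    by (simp only:) (intro finite_SigmaI finite_PiE finite_set_mset finite_atLeastAtMost)
qed

lemma PD_0: "PD 0 = 1"
proof -
  have "0 \<notin># M \<and> sum_mset M = 0 \<longleftrightarrow> M = {#}" for M :: "nat multiset"
    by (cases M) auto
  then have "designated_partitions 0
      = {(M, d). M = {#} \<and> d \<in> (\<Pi>\<^sub>E t\<in>set_mset M. {1..count M t})}"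
    unfolding designated_partitions_def conj_assoc[symmetric] by (simp only:)
  then have "designated_partitions 0 = {({#}, \<lambda>_. undefined)}"
    by auto
  then show ?thesis
    by (simp add: PD_def)
qed

text \<open>
  The symbol \<open>(a; q)\<^sub>\<infinity>\<close>. For formal power series the infinite product is taken
  in the \<open>X\<close>-adic topology, which is the library's topology on the type \<open>'a fps\<close>.
\<close>

definition qpoch_inf :: "'a::{t2_space,comm_ring_1} \<Rightarrow> 'a \<Rightarrow> 'a" where
  "qpoch_inf a q = (\<Prod>n. 1 - a * q ^ n)"

lemma has_prod_qpoch_inf_fps:
  fixes a q :: "complex fps"
  assumes "fps_nth a 0 = 0" "fps_nth q 0 = 0"
  shows "(\<lambda>n. 1 - a * q ^ n) has_prod qpoch_inf a q"
proof -
  define P where "P n = (\<Prod>i\<le>n. 1 - a * q ^ i)" for n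
  have sd: "fps_nth (P n * a * q ^ Suc n) j = 0" if "j \<le> n" for n j
  proof -
    have "fps_X * fps_shift 1 q = q"
      using assms(2) by (auto simp: fps_eq_iff)
    then have "q ^ Suc n = fps_X ^ Suc n * fps_shift 1 q ^ Suc n"
      by (metis power_mult_distrib)
    then have "P n * a * q ^ Suc n = fps_X ^ Suc n * (P n * a * fps_shift 1 q ^ Suc n)" by (simp only: ac_simps)
    thus ?thesis using that by (simp only: fps_X_power_mult_nth) simp
  qed
  have PS: "P (Suc n) = P n - P n * a * q ^ Suc n" for n by (simp add: P_def algebra_simps)
  have st: "fps_nth (P n) j = fps_nth (P j) j" if "j \<le> n" for n j
    using that by (induction n rule: dec_induct) (auto simp: PS sd simp del: power_Suc)
  have lim: "P \<longlonglongrightarrow> Abs_fps (\<lambda>j. fps_nth (P j) j)"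
    by (rule tendsto_fpsI, rule eventually_sequentiallyI, subst fps_nth_Abs_fps, erule st)
  have "fps_nth (P 0) 0 = 1" using assms by (simp add: P_def)
  hence "Abs_fps (\<lambda>j. fps_nth (P j) j) \<noteq> 0" by (metis fps_nth_Abs_fps fps_zero_nth zero_neq_one)
  hence "(\<lambda>n. 1 - a * q ^ n) has_prod Abs_fps (\<lambda>j. fps_nth (P j) j)"
    using lim unfolding has_prod_def raw_has_prod_def by (simp add: P_def[abs_def])
  thus ?thesis unfolding qpoch_inf_def by (metis has_prod_unique)
qed

end

theory Submission
  imports Defs "HOL-Computational_Algebra.Formal_Laurent_Series"
begin

text \<open>
  Write \<open>\<eta>\<^sub>k = (q\<^sup>k; q\<^sup>k)\<^sub>\<infinity>\<close>. A part size \<open>t\<close> contributes \<open>1 + \<Sum> m q\<^bsup>mt\<^esup>\<close> to the generating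
  function, which is therefore \<open>\<eta>\<^sub>6 / (\<eta>\<^sub>1 \<eta>\<^sub>2 \<eta>\<^sub>3)\<close>. The Jacobi triple product gives the
  3-dissections of \<open>\<phi>(-q) = \<eta>\<^sub>1\<^sup>2 / \<eta>\<^sub>2\<close> and \<open>\<psi>(q) = \<eta>\<^sub>2\<^sup>2 / \<eta>\<^sub>1\<close>, hence one of their product
  \<open>\<eta>\<^sub>1 \<eta>\<^sub>2\<close>: up to a factor in \<open>q\<^sup>3\<close> it is \<open>(u - 2 q v) (u + q v)\<close> with series \<open>u\<close>, \<open>v\<close> in \<open>q\<^sup>3\<close>.
  Replacing \<open>q\<close> by \<open>\<omega> q\<close> for the three cube roots of unity \<open>\<omega>\<close> and multiplying inverts this
  factor, the product of the \<open>\<eta>\<^sub>1 (\<omega> q)\<close> being \<open>\<eta>\<^sub>3\<^sup>4 / \<eta>\<^sub>9\<close>. The coefficients at \<open>q\<^bsup>3n+1\<^esup>\<close> can then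
  be read off.
\<close>

unbundle no vec_syntax
unbundle fps_syntax

section \<open>Limits of formal power series\<close>

text \<open>Convergence means that every coefficient is eventually constant. A coefficient of a sum,
  a product or \<open>f oo h\<close> with \<open>h\<close> fixed involves finitely many coefficients
  of the varying series, which gives this and the next limit laws.\<close>

lemma tendsto_add_fps [tendsto_intros]:
  fixes f g :: "'b \<Rightarrow> 'a::group_add fps"
  assumes "(f \<longlongrightarrow> a) F" "(g \<longlongrightarrow> b) F"
  shows "((\<lambda>x. f x + g x) \<longlongrightarrow> a + b) F"
proof (rule tendsto_fpsI)
  fix n
  have "\<forall>\<^sub>F x in F. f x $ n = a $ n" "\<forall>\<^sub>F x in F. g x $ n = b $ n"
    using assms by (auto simp: tendsto_fps_iff)
  then show "\<forall>\<^sub>F x in F. (f x + g x) $ n = (a + b) $ n"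
    by eventually_elim simp
qed

lemma tendsto_mult_fps [tendsto_intros]:
  fixes f g :: "'b \<Rightarrow> 'a::ring fps"
  assumes "(f \<longlongrightarrow> a) F" "(g \<longlongrightarrow> b) F"
  shows "((\<lambda>x. f x * g x) \<longlongrightarrow> a * b) F"
proof (rule tendsto_fpsI)
  fix n
  have "\<forall>\<^sub>F x in F. \<forall>i\<in>{0..n}. f x $ i = a $ i" "\<forall>\<^sub>F x in F. \<forall>i\<in>{0..n}. g x $ i = b $ i"
    using assms by (auto simp: tendsto_fps_iff eventually_ball_finite_distrib)
  then show "\<forall>\<^sub>F x in F. (f x * g x) $ n = (a * b) $ n"
    by eventually_elim (auto simp: fps_mult_nth intro!: sum.cong)
qed

lemma tendsto_power_fps [tendsto_intros]:
  fixes f :: "'b \<Rightarrow> 'a::ring_1 fps"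
  assumes "(f \<longlongrightarrow> a) F"
  shows "((\<lambda>x. f x ^ n) \<longlongrightarrow> a ^ n) F"
  by (induction n) (auto intro!: tendsto_intros assms)

lemma tendsto_compose_fps:
  fixes f :: "'b \<Rightarrow> 'a::comm_ring_1 fps"
  assumes "(f \<longlongrightarrow> a) F"
  shows "((\<lambda>x. f x oo h) \<longlongrightarrow> (a oo h)) F"
proof (rule tendsto_fpsI)
  fix n
  have "\<forall>\<^sub>F x in F. \<forall>i\<in>{0..n}. f x $ i = a $ i"
    using assms by (auto simp: tendsto_fps_iff eventually_ball_finite_distrib)
  then show "\<forall>\<^sub>F x in F. (f x oo h) $ n = (a oo h) $ n"
    by eventually_elim (auto simp: fps_compose_nth intro!: sum.cong)
qed

lemma tendsto_qpoch:
  fixes a q :: "complex fps"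
  assumes "a $ 0 = 0" "q $ 0 = 0"
  shows "(\<lambda>m. \<Prod>k<m. 1 - a * q ^ k) \<longlonglongrightarrow> qpoch_inf a q"
  using has_prod_imp_tendsto'[OF has_prod_qpoch_inf_fps[OF assms]] .

lemma qpoch_eqI:
  fixes a q :: "complex fps"
  assumes "a $ 0 = 0" "q $ 0 = 0" "(\<lambda>m. \<Prod>k<m. 1 - a * q ^ k) \<longlonglongrightarrow> L"
  shows "qpoch_inf a q = L"
  using tendsto_qpoch[OF assms(1,2)] assms(3) by (rule LIMSEQ_unique)

lemma prod_one_minus_nth_0:
  fixes a q :: "complex fps"
  assumes "a $ 0 = 0"
  shows "(\<Prod>k<m. 1 - a * q ^ k) $ 0 = 1"
  using assms by (induction m) simp_all

lemma qpoch_nth_0: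
  fixes a q :: "complex fps"
  assumes "a $ 0 = 0" "q $ 0 = 0"
  shows "qpoch_inf a q $ 0 = 1"
proof -
  have "\<forall>\<^sub>F m in sequentially. (\<Prod>k<m. 1 - a * q ^ k) $ 0 = qpoch_inf a q $ 0"
    using tendsto_qpoch[OF assms] by (simp add: tendsto_fps_iff)
  then show ?thesis
    using assms by (simp add: prod_one_minus_nth_0)
qed

section \<open>The Jacobi triple product\<close>

definition tri :: "int \<Rightarrow> nat" where
  "tri n = nat (n * (n + 1) div 2)"

lemma two_tri: "2 * int (tri n) = n * (n + 1)"
proof -
  have "n * (n + 1) \<ge> 0"
    by (cases "n \<ge> 0") (auto simp: zero_le_mult_iff)
  then show ?thesis
    by (simp add: tri_def)
qed

text \<open>Follows from \<open>n^2 - 3 |n| + 2 = (|n| - 1) (|n| - 2) >= 0\<close>. The bound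
  ensures that only finitely many terms of a theta series reach a given coefficient.\<close>

lemma tri_ge: "int (tri n) \<ge> \<bar>n\<bar> - 1"
proof -
  have "0 \<le> (\<bar>n\<bar> - 1) * (\<bar>n\<bar> - 2)"
    by (cases "\<bar>n\<bar> \<le> 1") (auto simp: zero_le_mult_iff)
  moreover have "2 * int (tri n) \<ge> n * n - \<bar>n\<bar>"
    unfolding two_tri by (simp add: algebra_simps)
  ultimately show ?thesis
    by (simp add: algebra_simps flip: power2_eq_square)
qed

text \<open>The reciprocal of \<open>(q; q)\<^sub>k\<close>. Extending it by \<open>0\<close> to negative \<open>k\<close>
  makes its recurrence hold for all \<open>k \<ge> 0\<close>, so that the finite form of the
  triple product needs no boundary cases.\<close>

definition inv_qpoch :: "complex fps \<Rightarrow> int \<Rightarrow> complex fps" where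
  "inv_qpoch q k = (if k < 0 then 0 else inverse (\<Prod>i<nat k. 1 - q * q ^ i))"

lemma inv_qpoch_rec:
  assumes "q $ 0 = 0" "k \<ge> 0"
  shows "inv_qpoch q (k - 1) = (1 - q ^ nat k) * inv_qpoch q k"
proof (cases "k = 0")
  case False
  then obtain m where m: "k = int (Suc m)"
    using assms(2) by (metis nonneg_int_cases not0_implies_Suc of_nat_0)
  then have nk: "nat k = Suc m" "nat (k - 1) = m" "\<not> k < 0" "\<not> k - 1 < 0"
    by auto
  let ?P = "\<Prod>i<m. 1 - q * q ^ i"
  have "?P $ 0 = 1"
    using assms by (intro prod_one_minus_nth_0)
  have "inv_qpoch q k = inverse ?P * inverse (1 - q ^ Suc m)"
    by (simp only: inv_qpoch_def nk if_False) (simp add: fps_inverse_mult)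
  moreover have "inverse (1 - q ^ Suc m) * (1 - q ^ Suc m) = 1"
    using assms by (intro inverse_mult_eq_1) simp
  ultimately have "(1 - q ^ nat k) * inv_qpoch q k = inverse ?P"
    unfolding nk by (simp add: ac_simps)
  then show ?thesis
    by (simp only: inv_qpoch_def nk if_False)
qed (simp add: inv_qpoch_def)

lemma inv_qpoch_0 [simp]: "inv_qpoch q 0 = 1"
  by (simp add: inv_qpoch_def)

lemma inv_qpoch_neg [simp]: "k < 0 \<Longrightarrow> inv_qpoch q k = 0"
  by (simp add: inv_qpoch_def)

lemma tendsto_inv_qpoch:
  assumes "q $ 0 = 0"
  shows "(\<lambda>m. inv_qpoch q (int m + c)) \<longlonglongrightarrow> inverse (qpoch_inf q q)"
proof -
  have "filterlim (\<lambda>m. nat (int m + c)) at_top sequentially"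
    unfolding filterlim_at_top
  proof
    fix Z
    show "\<forall>\<^sub>F m in sequentially. Z \<le> nat (int m + c)"
      using eventually_ge_at_top[of "Z + nat \<bar>c\<bar>"] by eventually_elim linarith
  qed
  then have "(\<lambda>m. \<Prod>i<nat (int m + c). 1 - q * q ^ i) \<longlonglongrightarrow> qpoch_inf q q"
    using tendsto_qpoch[OF assms assms] by (rule filterlim_compose[rotated])
  then have "(\<lambda>m. inverse (\<Prod>i<nat (int m + c). 1 - q * q ^ i)) \<longlonglongrightarrow> inverse (qpoch_inf q q)"
    by (rule tendsto_inverse_fps) (simp add: qpoch_nth_0 assms)
  moreover have "\<forall>\<^sub>F m in sequentially. inverse (\<Prod>i<nat (int m + c). 1 - q * q ^ i) = inv_qpoch q (int m + c)"
    using eventually_ge_at_top[of "nat \<bar>c\<bar>"] by eventually_elim (auto simp: inv_qpoch_def)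
  ultimately show ?thesis
    by (rule Lim_transform_eventually)
qed

text \<open>The general term of Ramanujan's theta function f(a, b), with exponents n(n+1)/2 and
  n(n-1)/2. Both are natural numbers, so no negative powers arise.\<close>

definition theta_term :: "'a::comm_ring_1 \<Rightarrow> 'a \<Rightarrow> int \<Rightarrow> 'a" where
  "theta_term a b n = a ^ tri n * b ^ tri (- n)"

text \<open>Passing from \<open>n - 1\<close> to \<open>n\<close> adds n to the exponent of a and n
  - 1 to that of b, so \<open>a\<close> times the old term is \<open>(a * b)\<close> to the power 1
  - n times the new one. The factor \<open>(a * b) ^ r\<close> keeps this exponent natural.\<close>

lemma theta_term_step:
  assumes "n \<le> int r + 1"
  shows "a * (a * b) ^ r * theta_term a b (n - 1) = (a * b) ^ nat (int r + 1 - n) * theta_term a b n"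
proof -
  have "2 * int (1 + r + tri (n - 1)) = 2 * int (nat (int r + 1 - n) + tri n)"
    unfolding of_nat_add distrib_left two_tri using assms by (simp add: algebra_simps)
  then have 1: "1 + r + tri (n - 1) = nat (int r + 1 - n) + tri n"
    by (simp only: mult_cancel_left of_nat_eq_iff) simp
  have "2 * int (r + tri (- (n - 1))) = 2 * int (nat (int r + 1 - n) + tri (- n))"
    unfolding of_nat_add distrib_left two_tri using assms by (simp add: algebra_simps)
  then have 2: "r + tri (- (n - 1)) = nat (int r + 1 - n) + tri (- n)"
    by (simp only: mult_cancel_left of_nat_eq_iff) simp
  have "a * (a * b) ^ r * theta_term a b (n - 1) = a ^ (1 + r + tri (n - 1)) * b ^ (r + tri (- (n - 1)))"
    by (simp add: theta_term_def power_mult_distrib power_add ac_simps)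
  also have "\<dots> = (a * b) ^ nat (int r + 1 - n) * theta_term a b n"
    unfolding 1 2 by (simp add: theta_term_def power_mult_distrib power_add ac_simps)
  finally show ?thesis .
qed

text \<open>The theta terms are weighted by Gaussian binomials "r + s choose r - n" in base
  \<open>a * b\<close>. Separate bounds \<open>r\<close> and \<open>s\<close> let the two products
  grow independently.\<close>

definition finite_theta :: "complex fps \<Rightarrow> complex fps \<Rightarrow> nat \<Rightarrow> nat \<Rightarrow> complex fps" where
  "finite_theta a b r s = (\<Sum>n\<in>{- int s..int r}.
     (\<Prod>i<r + s. 1 - (a * b) * (a * b) ^ i) * inv_qpoch (a * b) (int r - n)
       * inv_qpoch (a * b) (int s + n) * theta_term a b n)"

lemma theta_term_uminus: "theta_term b a (- n) = theta_term a b n"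
  by (simp add: theta_term_def mult.commute)

lemma finite_theta_commute: "finite_theta a b r s = finite_theta b a s r"
  unfolding finite_theta_def mult.commute[of b a] add.commute[of s r]
  by (rule sum.reindex_bij_witness[of _ uminus uminus])
     (auto simp: theta_term_uminus)

text \<open>This is the q-Pascal rule: with k = r + 1 - n and l = s + n, the two contributions to
  the n-th term combine by (1 - q^k) + q^k (1 - q^l) = 1 - q^(k+l).\<close>

lemma finite_theta_Suc:
  assumes "(a * b) $ 0 = 0"
  shows "finite_theta a b (Suc r) s = (1 + a * (a * b) ^ r) * finite_theta a b r s"
proof -
  define q where "q = a * b"
  have q: "q $ 0 = 0"
    using assms by (simp add: q_def)
  define P where "P m = (\<Prod>i<m. 1 - q * q ^ i)" for m
  define t where "t = theta_term a b"
  define I where "I = inv_qpoch q"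
  let ?S = "{- int s..int (Suc r)}"
  \<comment> \<open>The added index n = r + 1 contributes \<open>I (- 1) = 0\<close>; the shifted
    sum below likewise gains only a zero term, at n = - s.\<close>
  have 1: "finite_theta a b r s = (\<Sum>n\<in>?S. P (r + s) * I (int r - n) * I (int s + n) * t n)"
    unfolding finite_theta_def q_def[symmetric] P_def[symmetric] t_def[symmetric] I_def[symmetric]
    by (rule sum.mono_neutral_left) (auto simp: I_def)
  have "a * q ^ r * finite_theta a b r s
      = (\<Sum>n\<in>{- int s..int r}. P (r + s) * I (int r - n) * I (int s + n) * (a * q ^ r * t n))"
    unfolding finite_theta_def q_def[symmetric] P_def[symmetric] t_def[symmetric] I_def[symmetric]
    by (simp add: sum_distrib_left ac_simps)
  also have "\<dots> = (\<Sum>n\<in>{1 - int s..int (Suc r)}. P (r + s) * I (int r + 1 - n) * I (int s + n - 1) * (a * q ^ r * t (n - 1)))"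
    by (rule sum.reindex_bij_witness[of _ "\<lambda>n. n - 1" "\<lambda>n. n + 1"]) (auto simp: algebra_simps)
  also have "\<dots> = (\<Sum>n\<in>?S. P (r + s) * I (int r + 1 - n) * I (int s + n - 1) * (a * q ^ r * t (n - 1)))"
    by (rule sum.mono_neutral_left) (auto simp: I_def)
  finally have 2: "a * q ^ r * finite_theta a b r s = \<dots>" .
  have "(1 + a * q ^ r) * finite_theta a b r s = finite_theta a b r s + a * q ^ r * finite_theta a b r s"
    by (simp add: algebra_simps)
  also have "\<dots> = (\<Sum>n\<in>?S. P (r + s) * I (int r - n) * I (int s + n) * t n +
       P (r + s) * I (int r + 1 - n) * I (int s + n - 1) * (a * q ^ r * t (n - 1)))"
    unfolding 2 unfolding 1 by (simp add: sum.distrib)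
  also have "\<dots> = (\<Sum>n\<in>?S. P (Suc r + s) * I (int (Suc r) - n) * I (int s + n) * t n)"
  proof (rule sum.cong)
    fix n assume n: "n \<in> ?S"
    define k l where "k = nat (int r + 1 - n)" and "l = nat (int s + n)"
    have kl: "int k = int r + 1 - n" "int l = int s + n" "Suc (r + s) = k + l"
      using n by (auto simp: k_def l_def)
    have e: "int r - n = int k - 1" "int (Suc r) - n = int k" "int r + 1 - n = int k"
        "int s + n - 1 = int l - 1" "int s + n = int l"
      using kl by auto
    have Ik: "I (int k - 1) = (1 - q ^ k) * I (int k)"
      using inv_qpoch_rec[OF q, of "int k"] by (simp add: I_def)
    have Il: "I (int l - 1) = (1 - q ^ l) * I (int l)"
      using inv_qpoch_rec[OF q, of "int l"] by (simp add: I_def)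
    have t: "a * q ^ r * t (n - 1) = q ^ k * t n"
      unfolding t_def q_def k_def using n by (intro theta_term_step) auto
    have PS: "P (Suc r + s) = P (r + s) * (1 - q ^ k * q ^ l)"
      unfolding power_add[symmetric] kl(3)[symmetric] by (simp add: P_def)
    show "P (r + s) * I (int r - n) * I (int s + n) * t n +
         P (r + s) * I (int r + 1 - n) * I (int s + n - 1) * (a * q ^ r * t (n - 1))
       = P (Suc r + s) * I (int (Suc r) - n) * I (int s + n) * t n"
      unfolding e Ik Il t PS by (simp add: algebra_simps)
  qed simp
  also have "\<dots> = finite_theta a b (Suc r) s"
    unfolding finite_theta_def q_def[symmetric] P_def[symmetric] t_def[symmetric] I_def[symmetric] by simp
  finally show ?thesis
    by (simp add: q_def)
qed

lemma finite_theta_eq: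
  assumes "(a * b) $ 0 = 0"
  shows "finite_theta a b r s = (\<Prod>k<r. 1 + a * (a * b) ^ k) * (\<Prod>k<s. 1 + b * (a * b) ^ k)"
proof (induction r)
  case 0
  have ba: "(b * a) $ 0 = 0"
    using assms by (simp add: mult.commute)
  \<comment> \<open>With one bound 0, exchanging a and b lets the same recurrence produce the other
    product.\<close>
  have "finite_theta b a s 0 = (\<Prod>k<s. 1 + b * (b * a) ^ k)"
  proof (induction s)
    case 0
    then show ?case
      by (simp add: finite_theta_def theta_term_def tri_def)
  next
    case (Suc s)
    then show ?case
      unfolding finite_theta_Suc[OF ba] by (simp add: mult.commute)
  qed
  then show ?case
    unfolding finite_theta_commute[of a b 0 s] by (simp only: mult.commute[of b a]) simp
next
  case (Suc r)
  then show ?case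
    unfolding finite_theta_Suc[OF assms] by (simp add: ac_simps)
qed

text \<open>Both exponents exceed j, so the term is a multiple of \<open>(a * b) ^ Suc j\<close>,
  and X divides \<open>a * b\<close>. Only the product must vanish at 0, which admits
  \<open>b = 1\<close>.\<close>

lemma theta_term_nth_eq_0:
  fixes a b :: "complex fps"
  assumes "(a * b) $ 0 = 0" "\<bar>n\<bar> > int j + 1"
  shows "(f * theta_term a b n) $ j = 0"
proof -
  have "Suc j \<le> tri n" "Suc j \<le> tri (- n)"
    using tri_ge[of n] tri_ge[of "- n"] assms(2) by linarith+
  then obtain k l where kl: "tri n = Suc j + k" "tri (- n) = Suc j + l"
    by (metis le_Suc_ex)
  define c where "c = fps_shift 1 (a * b)"
  have "fps_X * c = a * b"
    unfolding c_def by (rule fps_ext) (use assms(1) in auto)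
  then have ab: "(a * b) ^ Suc j = fps_X ^ Suc j * c ^ Suc j"
    by (metis power_mult_distrib)
  have "f * theta_term a b n = (a * b) ^ Suc j * (f * a ^ k * b ^ l)"
    unfolding theta_term_def kl power_add by (simp only: power_mult_distrib ac_simps)
  also have "\<dots> = fps_X ^ Suc j * (c ^ Suc j * (f * a ^ k * b ^ l))"
    unfolding ab by (simp only: mult.assoc)
  finally have "f * theta_term a b n = \<dots>" .
  then show ?thesis
    by (simp only: fps_X_power_mult_nth) simp
qed

text \<open>The finite form with r = s = m is multiplied by \<open>Q\<close> and m tends to
  infinity. The products enter through their limits \<open>A\<close> and \<open>B\<close>, so that a
  factor with nonzero constant term is covered as well.\<close>

lemma jacobi_triple_product:
  fixes a b :: "complex fps"
  assumes q: "(a * b) $ 0 = 0"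
    and A: "(\<lambda>m. \<Prod>k<m. 1 + a * (a * b) ^ k) \<longlonglongrightarrow> A"
    and B: "(\<lambda>m. \<Prod>k<m. 1 + b * (a * b) ^ k) \<longlonglongrightarrow> B"
  shows "(\<lambda>m. \<Sum>n\<in>{- int m..int m}. theta_term a b n) \<longlonglongrightarrow> A * B * qpoch_inf (a * b) (a * b)"
proof (rule tendsto_fpsI)
  fix j
  define Q where "Q = qpoch_inf (a * b) (a * b)"
  have QQ: "Q * inverse Q = 1"
    unfolding Q_def by (subst mult.commute, rule inverse_mult_eq_1) (simp add: qpoch_nth_0[OF q q])
  \<comment> \<open>\<open>Q\<close> times the Gaussian binomial; for fixed n it tends to Q * Q / (Q
    * Q) = 1.\<close>
  define h where "h m n = Q * ((\<Prod>i<m + m. 1 - (a * b) * (a * b) ^ i)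
       * inv_qpoch (a * b) (int m - n) * inv_qpoch (a * b) (int m + n))" for m n
  have "(\<lambda>m. \<Prod>i<m + m. 1 - (a * b) * (a * b) ^ i) \<longlonglongrightarrow> Q"
    unfolding Q_def
    by (rule filterlim_compose[OF tendsto_qpoch[OF q q]]) (rule filterlim_at_top_mono[OF filterlim_ident], simp)
  then have "(\<lambda>m. h m n) \<longlonglongrightarrow> Q * (Q * inverse Q * inverse Q)" for n
    unfolding h_def using tendsto_inv_qpoch[OF q, of "- n"] tendsto_inv_qpoch[OF q, of n]
    by (intro tendsto_intros) (simp_all add: Q_def)
  then have "(\<lambda>m. h m n * theta_term a b n) \<longlonglongrightarrow> 1 * theta_term a b n" for n
    by (intro tendsto_intros) (simp add: QQ)
  then have 1: "\<forall>\<^sub>F m in sequentially. \<forall>n\<in>{- int j - 1..int j + 1}. (h m n * theta_term a b n) $ j = theta_term a b n $ j"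
    by (subst eventually_ball_finite_distrib) (auto simp: tendsto_fps_iff)
  have "(\<lambda>m. Q * finite_theta a b m m) \<longlonglongrightarrow> Q * (A * B)"
    unfolding finite_theta_eq[OF q] by (intro tendsto_intros A B)
  then have "\<forall>\<^sub>F m in sequentially. (Q * finite_theta a b m m) $ j = (Q * (A * B)) $ j"
    by (simp add: tendsto_fps_iff)
  with 1 show "\<forall>\<^sub>F m in sequentially. (\<Sum>n = - int m..int m. theta_term a b n) $ j
      = (A * B * qpoch_inf (a * b) (a * b)) $ j"
    using eventually_ge_at_top[of "j + 1"]
  proof eventually_elim
    case (elim m)
    have "(\<Sum>n\<in>{- int m..int m}. theta_term a b n) $ j = (\<Sum>n\<in>{- int m..int m}. theta_term a b n $ j)"
      by (simp add: fps_sum_nth)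
    \<comment> \<open>Coefficient j sees only these indices, a finite set independent of m, so the
      limit may be taken term by term.\<close>
    also have "\<dots> = (\<Sum>n\<in>{- int j - 1..int j + 1}. theta_term a b n $ j)"
      using elim(3) theta_term_nth_eq_0[OF q, where f = 1] by (intro sum.mono_neutral_right) auto
    also have "\<dots> = (\<Sum>n\<in>{- int j - 1..int j + 1}. (h m n * theta_term a b n) $ j)"
      using elim(1) by (intro sum.cong) auto
    also have "\<dots> = (\<Sum>n\<in>{- int m..int m}. (h m n * theta_term a b n) $ j)"
      using elim(3) theta_term_nth_eq_0[OF q] by (intro sum.mono_neutral_left) auto
    also have "\<dots> = (Q * finite_theta a b m m) $ j"
      by (simp add: fps_sum_nth finite_theta_def h_def sum_distrib_left mult.assoc)
    finally show ?case
      using elim(2) by (simp add: Q_def ac_simps)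
  qed
qed

section \<open>Eta products\<close>

text \<open>The factors are grouped by their index modulo d; the limit is compared along the partial
  products of length m * d.\<close>

lemma qpoch_mult_exponent:
  fixes a q :: "complex fps"
  assumes "a $ 0 = 0" "q $ 0 = 0" "d > 0"
  shows "qpoch_inf a q = (\<Prod>j<d. qpoch_inf (a * q ^ j) (q ^ d))"
proof (rule qpoch_eqI[OF assms(1,2)])
  have mult_d: "filterlim (\<lambda>m. m * d) at_top sequentially"
    by (rule filterlim_at_top_mono[OF filterlim_ident]) (use \<open>d > 0\<close> in simp)
  have 1: "(\<Prod>k<m * d. 1 - a * q ^ k) = (\<Prod>j<d. \<Prod>k<m. 1 - a * q ^ j * (q ^ d) ^ k)" for m
  proof (induction m)
    case (Suc m)
    have "(\<Prod>k<Suc m * d. 1 - a * q ^ k) = (\<Prod>k<m * d. 1 - a * q ^ k) * (\<Prod>k\<in>{m * d..<m * d + d}. 1 - a * q ^ k)"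
      by (subst prod.union_disjoint[symmetric]) (auto intro!: prod.cong)
    also have "(\<Prod>k\<in>{m * d..<m * d + d}. 1 - a * q ^ k) = (\<Prod>j<d. 1 - a * q ^ j * (q ^ d) ^ m)"
      using prod.shift_bounds_nat_ivl[of "\<lambda>k. 1 - a * q ^ k" 0 "m * d" d]
      by (simp add: atLeast0LessThan power_add ac_simps flip: power_mult)
    finally show ?case
      unfolding Suc by (simp add: prod.distrib)
  qed simp
  have lim: "(\<lambda>m. \<Prod>j<d'. \<Prod>k<m. 1 - a * q ^ j * (q ^ d) ^ k) \<longlonglongrightarrow> (\<Prod>j<d'. qpoch_inf (a * q ^ j) (q ^ d))" for d'
  proof (induction d')
    case (Suc d')
    have "(q ^ d) $ 0 = 0"
      using assms by (simp add: fps_power_zeroth)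
    then show ?case
      unfolding prod.lessThan_Suc using assms by (intro tendsto_mult_fps Suc tendsto_qpoch) auto
  qed simp
  have 2: "(\<lambda>m. \<Prod>k<m * d. 1 - a * q ^ k) \<longlonglongrightarrow> (\<Prod>j<d. qpoch_inf (a * q ^ j) (q ^ d))"
    unfolding 1 by (rule lim)
  have 3: "(\<lambda>m. \<Prod>k<m * d. 1 - a * q ^ k) \<longlonglongrightarrow> qpoch_inf a q"
    by (rule filterlim_compose[OF tendsto_qpoch[OF assms(1,2)] mult_d])
  show "(\<lambda>m. \<Prod>k<m. 1 - a * q ^ k) \<longlonglongrightarrow> (\<Prod>j<d. qpoch_inf (a * q ^ j) (q ^ d))"
    using LIMSEQ_unique[OF 2 3] tendsto_qpoch[OF assms(1,2)] by simp
qed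

lemma qpoch_uminus_mult:
  fixes a q :: "complex fps"
  assumes "a $ 0 = 0" "q $ 0 = 0"
  shows "qpoch_inf (- a) q * qpoch_inf a q = qpoch_inf (a ^ 2) (q ^ 2)"
proof (rule qpoch_eqI[symmetric])
  have "(\<Prod>k<m. 1 - a ^ 2 * (q ^ 2) ^ k) = (\<Prod>k<m. 1 - (- a) * q ^ k) * (\<Prod>k<m. 1 - a * q ^ k)" for m
    unfolding prod.distrib[symmetric]
    by (rule prod.cong) (simp_all add: algebra_simps power2_eq_square power_mult_distrib)
  then show "(\<lambda>m. \<Prod>k<m. 1 - a ^ 2 * (q ^ 2) ^ k) \<longlonglongrightarrow> qpoch_inf (- a) q * qpoch_inf a q"
    using assms by (simp only:) (intro tendsto_mult_fps tendsto_qpoch; simp)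
qed (use assms in \<open>simp_all add: power2_eq_square\<close>)

lemma qpoch_compose:
  fixes a q h :: "complex fps"
  assumes "a $ 0 = 0" "q $ 0 = 0" "h $ 0 = 0"
  shows "qpoch_inf a q oo h = qpoch_inf (a oo h) (q oo h)"
proof (rule qpoch_eqI[symmetric])
  have "(\<Prod>k<m. 1 - a * q ^ k) oo h = (\<Prod>k<m. 1 - (a oo h) * (q oo h) ^ k)" for m
    by (simp add: assms fps_compose_prod_distrib fps_compose_sub_distrib fps_compose_mult_distrib fps_compose_power)
  with tendsto_compose_fps[OF tendsto_qpoch[OF assms(1,2)], of h]
  show "(\<lambda>m. \<Prod>k<m. 1 - (a oo h) * (q oo h) ^ k) \<longlonglongrightarrow> (qpoch_inf a q oo h)"
    by simp
qed (use assms in simp_all)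

lemma prod_lessThan_3: "(\<Prod>j<3. f j) = f 0 * f 1 * f (2 :: nat)"
  by (simp add: eval_nat_numeral)

text \<open>Dedekind's \<open>\<eta>(k\<tau>)\<close> without its fractional power of \<open>q\<close>.\<close>

definition eta :: "nat \<Rightarrow> complex fps" where
  "eta k = qpoch_inf (fps_X ^ k) (fps_X ^ k)"

lemma eta_nth_0: "k > 0 \<Longrightarrow> eta k $ 0 = 1"
  by (simp add: eta_def qpoch_nth_0)

lemma eta_neq_0: "k > 0 \<Longrightarrow> eta k \<noteq> 0"
  using eta_nth_0[of k] by auto

lemma eta_compose:
  "k > 0 \<Longrightarrow> h $ 0 = 0 \<Longrightarrow> eta k oo h = qpoch_inf (h ^ k) (h ^ k)"
  by (simp add: eta_def qpoch_compose flip: fps_compose_power)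

lemma eta_compose_X_power: "k > 0 \<Longrightarrow> j > 0 \<Longrightarrow> eta k oo fps_X ^ j = eta (j * k)"
  by (subst eta_compose) (simp_all add: eta_def power_mult)

lemma qpoch_odd_mult_eta: "k > 0 \<Longrightarrow> qpoch_inf (fps_X ^ k) (fps_X ^ (2 * k)) * eta (2 * k) = eta k"
  using qpoch_mult_exponent[of "fps_X ^ k" "fps_X ^ k" 2]
  by (simp add: eta_def numeral_2_eq_2 power_add ac_simps flip: power_mult)

lemma qpoch_uminus_mult_eta: "k > 0 \<Longrightarrow> qpoch_inf (- (fps_X ^ k)) (fps_X ^ k) * eta k = eta (2 * k)"
  using qpoch_uminus_mult[of "fps_X ^ k" "fps_X ^ k"]
  by (simp add: eta_def mult.commute flip: power_mult)

section \<open>Theta series\<close>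

abbreviation theta_sum :: "complex fps \<Rightarrow> complex fps \<Rightarrow> nat \<Rightarrow> complex fps" where
  "theta_sum a b m \<equiv> \<Sum>n\<in>{- int m..int m}. theta_term a b n"

lemma prod_one_plus_LIMSEQ:
  fixes a q :: "complex fps"
  assumes "a $ 0 = 0" "q $ 0 = 0"
  shows "(\<lambda>m. \<Prod>k<m. 1 + a * q ^ k) \<longlonglongrightarrow> qpoch_inf (- a) q"
  using tendsto_qpoch[of "- a" q] assms by simp

text \<open>The triple product at a = b = -q sums (-1)^n q^(n^2), the series of phi(-q). Here
  \<open>a * b\<close> is q^2, so the product side is (q; q^2)^2 (q^2; q^2).\<close>

lemma theta_sum_phi:
  obtains L where "theta_sum (- fps_X) (- fps_X) \<longlonglongrightarrow> L" "L * eta 2 = eta 1 ^ 2"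
proof
  let ?p = "qpoch_inf (fps_X ^ 1) (fps_X ^ 2) :: complex fps"
  have "theta_sum (- fps_X) (- fps_X) \<longlonglongrightarrow>
      qpoch_inf (- (- fps_X)) (- fps_X * - fps_X) * qpoch_inf (- (- fps_X)) (- fps_X * - fps_X)
        * qpoch_inf (- fps_X * - fps_X) (- fps_X * - fps_X)"
    by (intro jacobi_triple_product prod_one_plus_LIMSEQ) simp_all
  then show "theta_sum (- fps_X) (- fps_X) \<longlonglongrightarrow> ?p * ?p * eta 2"
    by (simp add: eta_def power2_eq_square)
  show "?p * ?p * eta 2 * eta 2 = eta 1 ^ 2"
    unfolding qpoch_odd_mult_eta[of 1, simplified mult_1_right, OF zero_less_one, symmetric]
    by (simp only: power2_eq_square ac_simps)
qed

text \<open>At a = q, b = 1 the sum over all integers n of q^(n(n+1)/2) meets each triangular number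
  twice, so the limit is 2 psi(q).\<close>

lemma theta_sum_psi:
  obtains L where "theta_sum fps_X 1 \<longlonglongrightarrow> L" "L * eta 1 = 2 * eta 2 ^ 2"
proof
  let ?p = "qpoch_inf (- (fps_X ^ 1)) (fps_X ^ 1) :: complex fps"
  have X: "(\<lambda>m. \<Prod>k<m. 1 + fps_X * fps_X ^ k) \<longlonglongrightarrow> ?p"
    using prod_one_plus_LIMSEQ[of fps_X fps_X] by simp
  \<comment> \<open>The factor at k = 0 is 1 + 1; the others are those of the product for
    \<open>a = fps_X\<close>.\<close>
  have "(\<Prod>k<Suc m. 1 + 1 * fps_X ^ k) = 2 * (\<Prod>k<m. 1 + fps_X * fps_X ^ k :: complex fps)" for m
    by (subst prod.lessThan_Suc_shift) simp
  with tendsto_mult_fps[OF tendsto_const[of "2 :: complex fps"] X]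
  have "(\<lambda>m. \<Prod>k<Suc m. 1 + 1 * fps_X ^ k) \<longlonglongrightarrow> 2 * ?p"
    by (simp only:)
  then have 1: "(\<lambda>m. \<Prod>k<m. 1 + 1 * fps_X ^ k) \<longlonglongrightarrow> 2 * ?p"
    by (rule LIMSEQ_imp_Suc)
  show "theta_sum fps_X 1 \<longlonglongrightarrow> ?p * (2 * ?p) * eta 1"
    using jacobi_triple_product[of fps_X 1 ?p "2 * ?p"] X 1 by (simp add: eta_def)
  show "?p * (2 * ?p) * eta 1 * eta 1 = 2 * eta 2 ^ 2"
    unfolding qpoch_uminus_mult_eta[of 1, simplified mult_1_right, OF zero_less_one, symmetric]
    by (simp only: power2_eq_square ac_simps)
qed

text \<open>The series accompanying phi in its 3-dissection. Its product runs over the residues 1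
  and 5 modulo 6, which is (q; q^2) without the residue 3, times \<open>eta 6\<close>.\<close>

lemma theta_sum_phi_aux:
  obtains L where "theta_sum (- (fps_X ^ 5)) (- fps_X) \<longlonglongrightarrow> L"
    "L * eta 2 * eta 3 = eta 1 * eta 6 ^ 2"
proof
  let ?p = "\<lambda>k. qpoch_inf (fps_X ^ k) (fps_X ^ 6) :: complex fps"
  have "theta_sum (- (fps_X ^ 5)) (- fps_X) \<longlonglongrightarrow>
      qpoch_inf (- (- (fps_X ^ 5))) (- (fps_X ^ 5) * - fps_X) * qpoch_inf (- (- fps_X)) (- (fps_X ^ 5) * - fps_X)
        * qpoch_inf (- (fps_X ^ 5) * - fps_X) (- (fps_X ^ 5) * - fps_X)"
    by (intro jacobi_triple_product prod_one_plus_LIMSEQ) simp_all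
  moreover have "- (fps_X ^ 5) * - fps_X = (fps_X ^ 6 :: complex fps)"
    by (simp add: eval_nat_numeral)
  ultimately show "theta_sum (- (fps_X ^ 5)) (- fps_X) \<longlonglongrightarrow> ?p 5 * ?p 1 * eta 6"
    by (simp only: eta_def minus_minus power_one_right)
  have "qpoch_inf (fps_X ^ 1) (fps_X ^ 2) = ?p 1 * ?p 3 * ?p 5"
    using qpoch_mult_exponent[of "fps_X ^ 1" "fps_X ^ 2" 3]
    by (simp add: prod_lessThan_3 flip: power_mult power_Suc)
  then have "eta 1 = ?p 1 * ?p 3 * ?p 5 * eta 2"
    using qpoch_odd_mult_eta[of 1] by simp
  moreover have "?p 3 * eta 6 = eta 3"
    using qpoch_odd_mult_eta[of 3] by simp
  ultimately show "?p 5 * ?p 1 * eta 6 * eta 2 * eta 3 = eta 1 * eta 6 ^ 2"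
    by (simp add: power2_eq_square ac_simps)
qed

text \<open>The companion of psi. Its product is (-q; q) = \<open>eta 2\<close> /
  \<open>eta 1\<close> without the multiples of 3, times \<open>eta 3\<close>.\<close>

lemma theta_sum_psi_aux:
  obtains L where "theta_sum (fps_X ^ 2) fps_X \<longlonglongrightarrow> L"
    "L * eta 1 * eta 6 = eta 2 * eta 3 ^ 2"
proof
  let ?p = "\<lambda>k. qpoch_inf (- (fps_X ^ k)) (fps_X ^ 3) :: complex fps"
  have "theta_sum (fps_X ^ 2) fps_X \<longlonglongrightarrow>
      qpoch_inf (- (fps_X ^ 2)) (fps_X ^ 2 * fps_X) * qpoch_inf (- fps_X) (fps_X ^ 2 * fps_X)
        * qpoch_inf (fps_X ^ 2 * fps_X) (fps_X ^ 2 * fps_X)"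
    by (intro jacobi_triple_product prod_one_plus_LIMSEQ) simp_all
  moreover have "fps_X ^ 2 * fps_X = (fps_X ^ 3 :: complex fps)"
    by (simp add: eval_nat_numeral)
  ultimately show "theta_sum (fps_X ^ 2) fps_X \<longlonglongrightarrow> ?p 2 * ?p 1 * eta 3"
    by (simp only: eta_def power_one_right)
  have X_powers: "fps_X * fps_X = (fps_X ^ 2 :: complex fps)" "fps_X * fps_X ^ 2 = (fps_X ^ 3 :: complex fps)"
    by (simp_all add: eval_nat_numeral)
  have "qpoch_inf (- (fps_X ^ 1)) (fps_X ^ 1) = ?p 1 * ?p 2 * ?p 3"
    using qpoch_mult_exponent[of "- (fps_X ^ 1)" "fps_X ^ 1" 3]
    by (simp add: prod_lessThan_3 X_powers)
  then have "eta 2 = ?p 1 * ?p 2 * ?p 3 * eta 1"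
    using qpoch_uminus_mult_eta[of 1] by simp
  moreover have "?p 3 * eta 3 = eta 6"
    using qpoch_uminus_mult_eta[of 3] by simp
  ultimately show "?p 2 * ?p 1 * eta 3 * eta 1 * eta 6 = eta 2 * eta 3 ^ 2"
    by (simp add: power2_eq_square ac_simps)
qed

section \<open>3-dissection of the theta series\<close>

lemma sum_symmetric_Suc:
  fixes f :: "int \<Rightarrow> 'a::comm_monoid_add"
  shows "(\<Sum>n\<in>{- int (Suc m)..int (Suc m)}. f n)
       = f (- int (Suc m)) + f (int (Suc m)) + (\<Sum>n\<in>{- int m..int m}. f n)"
proof -
  have "{- int (Suc m)..int (Suc m)} = insert (- int (Suc m)) (insert (int (Suc m)) {- int m..int m})"
    by auto
  then show ?thesis
    by (simp add: add.assoc)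
qed

text \<open>The triples 3k - 1, 3k, 3k + 1 with |k| <= m fill the range up to 3m + 1 exactly, so
  truncated sums dissect without remainder.\<close>

lemma sum_trisection:
  fixes f :: "int \<Rightarrow> 'a::comm_monoid_add"
  shows "(\<Sum>n\<in>{- int (3 * m + 1)..int (3 * m + 1)}. f n)
       = (\<Sum>k\<in>{- int m..int m}. f (3 * k) + f (3 * k + 1) + f (3 * k - 1))"
proof (induction m)
  case 0
  have "{- 1..1} = {- 1, 0, 1 :: int}"
    by auto
  then show ?case
    by (simp add: ac_simps)
next
  case (Suc m)
  have "3 * Suc m + 1 = Suc (Suc (Suc (3 * m + 1)))"
    by simp
  then show ?case
    by (simp only: sum_symmetric_Suc Suc) (simp add: algebra_simps)
qed

lemma X_power_compose:
  fixes e j :: nat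
  assumes "j > 0"
  shows "(fps_X ^ e oo fps_X ^ j) = (fps_X ^ (j * e) :: complex fps)"
  using assms by (simp add: power_mult flip: fps_compose_power)

lemma uminus_X_power_compose:
  fixes e j :: nat
  assumes "odd j"
  shows "((- fps_X) ^ e oo fps_X ^ j) = ((- fps_X) ^ (j * e) :: complex fps)"
  using assms by (simp add: power_mult fps_compose_uminus odd_pos flip: fps_compose_power)

text \<open>Doubling removes the division in \<open>tri\<close> and reduces equality of exponents to
  a polynomial identity over the integers.\<close>

lemma tri_sum_eqI:
  assumes "int a * (n * (n + 1)) + int b * (n * (n - 1)) + 2 * int c
         = int a' * (k * (k + 1)) + int b' * (k * (k - 1)) + 2 * int c'"
  shows "a * tri n + b * tri (- n) + c = a' * tri k + b' * tri (- k) + c'"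
proof -
  have 1: "2 * int (a * tri n + b * tri (- n) + c)
      = int a * (2 * int (tri n)) + int b * (2 * int (tri (- n))) + 2 * int c" for a b c n
    by (simp add: algebra_simps)
  have "2 * int (a * tri n + b * tri (- n) + c) = 2 * int (a' * tri k + b' * tri (- k) + c')"
    unfolding 1 two_tri using assms by (simp add: algebra_simps)
  then show ?thesis
    by (simp only: mult_cancel_left of_nat_eq_iff) simp
qed

text \<open>For n = 3k the square is 9 k^2; for n = 3k + 1 it is 1 + 3 (3 k^2 + 2 k). The class 3k -
  1 mirrors the latter under k -> -k, whence the factor 2.\<close>

lemma theta_sum_phi_trisection:
  "theta_sum (- fps_X) (- fps_X) (3 * m + 1)
    = (theta_sum (- fps_X) (- fps_X) m oo fps_X ^ 9)
      - 2 * fps_X * (theta_sum (- (fps_X ^ 5)) (- fps_X) m oo fps_X ^ 3)"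
proof -
  have 1: "theta_term (- fps_X) (- fps_X) n = (- fps_X :: complex fps) ^ (tri n + tri (- n))" for n
    by (simp add: theta_term_def power_add)
  have 2: "theta_term (- (fps_X ^ 5)) (- fps_X) n = (- fps_X :: complex fps) ^ (5 * tri n + tri (- n))" for n
    unfolding power_add power_mult by (simp add: theta_term_def)
  have e: "tri (3 * k) + tri (- (3 * k)) = 9 * (tri k + tri (- k))"
    "tri (3 * k + 1) + tri (- (3 * k + 1)) = Suc (3 * (5 * tri k + tri (- k)))"
    "tri (3 * k - 1) + tri (- (3 * k - 1)) = Suc (3 * (5 * tri (- k) + tri (- (- k))))" for k
    using tri_sum_eqI[of 1 "3 * k" 1 0 9 k 9 0] tri_sum_eqI[of 1 "3 * k + 1" 1 0 15 k 3 1]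
      tri_sum_eqI[of 1 "3 * k - 1" 1 0 15 "- k" 3 1]
    by (simp_all add: algebra_simps)
  have "theta_sum (- fps_X) (- fps_X) (3 * m + 1) = (\<Sum>k\<in>{- int m..int m}.
      (theta_term (- fps_X) (- fps_X) k oo fps_X ^ 9)
      - fps_X * (theta_term (- (fps_X ^ 5)) (- fps_X) k oo fps_X ^ 3)
      - fps_X * (theta_term (- (fps_X ^ 5)) (- fps_X) (- k) oo fps_X ^ 3))"
    unfolding sum_trisection 1 2 e by (simp add: uminus_X_power_compose algebra_simps)
  also have "\<dots> = (theta_sum (- fps_X) (- fps_X) m oo fps_X ^ 9)
      - fps_X * (\<Sum>k\<in>{- int m..int m}. theta_term (- (fps_X ^ 5)) (- fps_X) k oo fps_X ^ 3)
      - fps_X * (\<Sum>k\<in>{- int m..int m}. theta_term (- (fps_X ^ 5)) (- fps_X) (- k) oo fps_X ^ 3)"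
    by (simp add: sum_subtractf sum_distrib_left fps_compose_sum_distrib)
  also have "(\<Sum>k\<in>{- int m..int m}. theta_term (- (fps_X ^ 5)) (- fps_X) (- k) oo fps_X ^ 3)
      = (\<Sum>k\<in>{- int m..int m}. theta_term (- (fps_X ^ 5)) (- fps_X) k oo fps_X ^ 3)"
    by (rule sum.reindex_bij_witness[of _ uminus uminus]) auto
  finally show ?thesis
    by (simp add: fps_compose_sum_distrib)
qed

text \<open>Here the classes 3k and 3k - 1 mirror each other, while 3k + 1 reproduces the series
  itself in q^9, since its triangular number is 1 + 9 k(k+1)/2.\<close>

lemma theta_sum_psi_trisection:
  "theta_sum fps_X 1 (3 * m + 1)
    = 2 * (theta_sum (fps_X ^ 2) fps_X m oo fps_X ^ 3) + fps_X * (theta_sum fps_X 1 m oo fps_X ^ 9)"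
proof -
  have 1: "theta_term fps_X 1 n = (fps_X :: complex fps) ^ tri n" for n
    by (simp add: theta_term_def)
  have 2: "theta_term (fps_X ^ 2) fps_X n = (fps_X :: complex fps) ^ (2 * tri n + tri (- n))" for n
    unfolding power_add power_mult by (simp add: theta_term_def)
  have e: "tri (3 * k) = 3 * (2 * tri k + tri (- k))"
    "tri (3 * k + 1) = Suc (9 * tri k)"
    "tri (3 * k - 1) = 3 * (2 * tri (- k) + tri (- (- k)))" for k
    using tri_sum_eqI[of 1 "3 * k" 0 0 6 k 3 0] tri_sum_eqI[of 1 "3 * k + 1" 0 0 9 k 0 1]
      tri_sum_eqI[of 1 "3 * k - 1" 0 0 6 "- k" 3 0]
    by (simp_all add: algebra_simps)
  have "theta_sum fps_X 1 (3 * m + 1) = (\<Sum>k\<in>{- int m..int m}.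
      (theta_term (fps_X ^ 2) fps_X k oo fps_X ^ 3)
      + fps_X * (theta_term fps_X 1 k oo fps_X ^ 9)
      + (theta_term (fps_X ^ 2) fps_X (- k) oo fps_X ^ 3))"
    unfolding sum_trisection 1 2 e by (simp add: X_power_compose)
  also have "\<dots> = (\<Sum>k\<in>{- int m..int m}. theta_term (fps_X ^ 2) fps_X k oo fps_X ^ 3)
      + fps_X * (theta_sum fps_X 1 m oo fps_X ^ 9)
      + (\<Sum>k\<in>{- int m..int m}. theta_term (fps_X ^ 2) fps_X (- k) oo fps_X ^ 3)"
    by (simp add: sum.distrib sum_distrib_left fps_compose_sum_distrib)
  also have "(\<Sum>k\<in>{- int m..int m}. theta_term (fps_X ^ 2) fps_X (- k) oo fps_X ^ 3)
      = (\<Sum>k\<in>{- int m..int m}. theta_term (fps_X ^ 2) fps_X k oo fps_X ^ 3)"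
    by (rule sum.reindex_bij_witness[of _ uminus uminus]) auto
  finally show ?thesis
    by (simp add: fps_compose_sum_distrib)
qed

lemma LIMSEQ_trisection:
  fixes L L' :: "'a::t2_space"
  assumes "f \<longlonglongrightarrow> L" "(\<lambda>m. f (3 * m + 1)) \<longlonglongrightarrow> L'"
  shows "L = L'"
proof -
  have "filterlim (\<lambda>m::nat. 3 * m + 1) at_top sequentially"
    by (rule filterlim_at_top_mono[OF filterlim_ident]) simp
  from LIMSEQ_unique[OF filterlim_compose[OF assms(1) this] assms(2)] show ?thesis .
qed

text \<open>Both dissections are cleared of denominators and multiplied. The limits
  \<open>\<phi>\<close> and \<open>\<psi>\<close> satisfy
  \<open>\<phi> * \<psi> = 2 * (eta 1 * eta 2)\<close>.\<close>

lemma eta_1_eta_2_trisection: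
  "eta 1 * eta 2 * (eta 3 * eta 6 * eta 9 ^ 2 * eta 18 ^ 2)
    = (eta 6 * eta 9 ^ 3 - 2 * fps_X * (eta 3 * eta 18 ^ 3)) * (eta 6 * eta 9 ^ 3 + fps_X * (eta 3 * eta 18 ^ 3))"
proof -
  obtain \<phi> where \<phi>: "theta_sum (- fps_X) (- fps_X) \<longlonglongrightarrow> \<phi>" "\<phi> * eta 2 = eta 1 ^ 2"
    by (rule theta_sum_phi)
  obtain \<psi> where \<psi>: "theta_sum fps_X 1 \<longlonglongrightarrow> \<psi>" "\<psi> * eta 1 = 2 * eta 2 ^ 2"
    by (rule theta_sum_psi)
  obtain F where F: "theta_sum (- (fps_X ^ 5)) (- fps_X) \<longlonglongrightarrow> F" "F * eta 2 * eta 3 = eta 1 * eta 6 ^ 2"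
    by (rule theta_sum_phi_aux)
  obtain G where G: "theta_sum (fps_X ^ 2) fps_X \<longlonglongrightarrow> G" "G * eta 1 * eta 6 = eta 2 * eta 3 ^ 2"
    by (rule theta_sum_psi_aux)
  let ?c = "\<lambda>f j. f oo (fps_X ^ j :: complex fps)"
  \<comment> \<open>Puts the dissection into the form handled by the limit rules for sums and
    products.\<close>
  have minus_2: "a - 2 * fps_X * b = a + (- 2 * fps_X) * b" for a b :: "complex fps"
    by simp
  have 1: "\<phi> = ?c \<phi> 9 + (- 2 * fps_X) * ?c F 3"
    by (rule LIMSEQ_trisection[OF \<phi>(1)], unfold theta_sum_phi_trisection minus_2)
       (intro tendsto_intros tendsto_compose_fps \<phi> F)
  have 2: "\<psi> = 2 * ?c G 3 + fps_X * ?c \<psi> 9"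
    by (rule LIMSEQ_trisection[OF \<psi>(1)], unfold theta_sum_psi_trisection)
       (intro tendsto_intros tendsto_compose_fps \<psi> G)
  note comp = fps_compose_mult_distrib fps_compose_power[symmetric] eta_compose_X_power
  \<comment> \<open>The product formulas are transported along q -> q^9 and q -> q^3.\<close>
  have 3: "?c \<phi> 9 * eta 18 = eta 9 ^ 2"
    using arg_cong[OF \<phi>(2), of "\<lambda>f. ?c f 9"] by (simp add: comp)
  have 4: "?c F 3 * eta 6 * eta 9 = eta 3 * eta 18 ^ 2"
    using arg_cong[OF F(2), of "\<lambda>f. ?c f 3"] by (simp add: comp)
  have 5: "?c \<psi> 9 * eta 9 = 2 * eta 18 ^ 2"
    using arg_cong[OF \<psi>(2), of "\<lambda>f. ?c f 9"] by (simp add: comp)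
  have 6: "?c G 3 * eta 3 * eta 18 = eta 6 * eta 9 ^ 2"
    using arg_cong[OF G(2), of "\<lambda>f. ?c f 3"] by (simp add: comp)
  have "\<phi> * (eta 6 * eta 9 * eta 18)
      = (?c \<phi> 9 * eta 18) * eta 6 * eta 9 - 2 * fps_X * (?c F 3 * eta 6 * eta 9) * eta 18"
    by (subst 1) (simp add: algebra_simps)
  also have "\<dots> = eta 6 * eta 9 ^ 3 - 2 * fps_X * (eta 3 * eta 18 ^ 3)"
    unfolding 3 4 by (simp add: power2_eq_square power3_eq_cube algebra_simps)
  finally have 7: "\<phi> * (eta 6 * eta 9 * eta 18) = \<dots>" .
  have "\<psi> * (eta 3 * eta 9 * eta 18)
      = 2 * (?c G 3 * eta 3 * eta 18) * eta 9 + fps_X * (?c \<psi> 9 * eta 9) * eta 3 * eta 18"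
    by (subst 2) (simp add: algebra_simps)
  also have "\<dots> = 2 * (eta 6 * eta 9 ^ 3 + fps_X * (eta 3 * eta 18 ^ 3))"
    unfolding 5 6 by (simp add: power2_eq_square power3_eq_cube algebra_simps)
  finally have 8: "\<psi> * (eta 3 * eta 9 * eta 18) = \<dots>" .
  have "(\<phi> * \<psi>) * (eta 1 * eta 2) = (2 * (eta 1 * eta 2)) * (eta 1 * eta 2)"
    using \<phi>(2) \<psi>(2) by (simp add: power2_eq_square) algebra
  then have 9: "\<phi> * \<psi> = 2 * (eta 1 * eta 2)"
    using eta_neq_0[of 1] eta_neq_0[of 2] by (simp only: mult_cancel_right) auto
  have "2 * (eta 1 * eta 2 * (eta 3 * eta 6 * eta 9 ^ 2 * eta 18 ^ 2))
      = (\<phi> * (eta 6 * eta 9 * eta 18)) * (\<psi> * (eta 3 * eta 9 * eta 18))"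
  proof -
    have "2 * (eta 1 * eta 2 * (eta 3 * eta 6 * eta 9 ^ 2 * eta 18 ^ 2))
        = (2 * (eta 1 * eta 2)) * (eta 3 * eta 6 * eta 9 ^ 2 * eta 18 ^ 2)"
      by (simp only: ac_simps)
    then show ?thesis
      unfolding 9[symmetric] by (simp only: power2_eq_square ac_simps)
  qed
  also have "\<dots> = 2 * ((eta 6 * eta 9 ^ 3 - 2 * fps_X * (eta 3 * eta 18 ^ 3))
      * (eta 6 * eta 9 ^ 3 + fps_X * (eta 3 * eta 18 ^ 3)))"
    unfolding 7 8 by (simp only: ac_simps)
  finally show ?thesis
    by (simp only: mult_cancel_left) simp
qed

section \<open>Multisection\<close>

lemma cube_root_prod:
  fixes w u c :: "'a::comm_ring_1"
  assumes "w ^ 2 + w + 1 = 0"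
  shows "(u + c) * (u + w * c) * (u + w ^ 2 * c) = u ^ 3 + c ^ 3"
proof -
  have w: "w ^ 2 = - 1 - w"
    using assms by (simp add: eq_neg_iff_add_eq_0 algebra_simps)
  then have ww: "w * w = - 1 - w"
    by (simp add: power2_eq_square)
  have "(u + w * c) * (u + w ^ 2 * c) = u ^ 2 - u * c - (w * w + w) * c ^ 2"
    unfolding w by (simp add: algebra_simps power2_eq_square)
  also have "\<dots> = u ^ 2 - u * c + c ^ 2"
    unfolding ww by simp
  finally have "(u + c) * ((u + w * c) * (u + w ^ 2 * c)) = (u + c) * \<dots>"
    by (simp only:)
  then show ?thesis
    by (simp add: algebra_simps power2_eq_square power3_eq_cube)
qed

lemma cube_root_pow_3:
  fixes w :: "'a::comm_ring_1"
  assumes "w ^ 2 + w + 1 = 0"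
  shows "w ^ 3 = 1"
proof -
  have "w ^ 3 - 1 = (w - 1) * (w ^ 2 + w + 1)"
    by (simp add: algebra_simps power2_eq_square power3_eq_cube)
  then show ?thesis
    using assms by simp
qed

lemma cube_root_square:
  fixes w :: "'a::comm_ring_1"
  assumes "w ^ 2 + w + 1 = 0"
  shows "(w ^ 2) ^ 2 = w" "(w ^ 2) ^ 2 + w ^ 2 + 1 = 0"
proof -
  have "(w ^ 2) ^ 2 = w ^ 3 * w"
    by (simp add: eval_nat_numeral ac_simps)
  then show 1: "(w ^ 2) ^ 2 = w"
    using cube_root_pow_3[OF assms] by simp
  show "(w ^ 2) ^ 2 + w ^ 2 + 1 = 0"
    unfolding 1 using assms by (simp add: ac_simps)
qed

text \<open>If 3 does not divide n, the factors 1 - (w^i y)^n multiply to 1 - y^(3n); otherwise they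
  coincide and give a cube. \<open>P (y ^ 9) m\<close> supplies the factors 1 - y^(3n) missing at
  multiples of 3.\<close>

lemma finite_qpoch_norm:
  fixes w y :: "'a::comm_ring_1"
  assumes w: "w ^ 2 + w + 1 = 0"
  defines "P \<equiv> \<lambda>x m. \<Prod>k<m. 1 - x * x ^ k"
  shows "P y (3 * m) * P (w * y) (3 * m) * P (w ^ 2 * y) (3 * m) * P (y ^ 9) m
       = P (y ^ 3) (3 * m) * P (y ^ 3) m ^ 3"
proof (induction m)
  case 0
  then show ?case
    by (simp add: P_def)
next
  case (Suc m)
  define t where "t = y ^ (3 * m)"
  note w3 = cube_root_pow_3[OF w]
  have w23: "(w ^ 2) ^ 3 = 1"
    unfolding power_mult[symmetric] using w3 by (metis mult.commute power_mult power_one)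
  have t: "(w * y) ^ (3 * m) = t" "(w ^ 2 * y) ^ (3 * m) = t" "(y ^ 9) ^ m = t ^ 3"
    "(y ^ 3) ^ (3 * m) = t ^ 3" "(y ^ 3) ^ m = t"
    unfolding t_def power_mult power_mult_distrib w3 w23
    by (simp_all add: power_mult[symmetric] ac_simps)
  have P3: "P x (3 * Suc m) = P x (3 * m) * ((1 - x * x ^ (3 * m)) * (1 - x ^ 2 * x ^ (3 * m)) * (1 - x ^ 3 * x ^ (3 * m)))" for x
  proof -
    have "3 * Suc m = Suc (Suc (Suc (3 * m)))"
      by simp
    then show ?thesis
      by (simp only: P_def prod.lessThan_Suc) (simp add: eval_nat_numeral ac_simps)
  qed
  have f: "(1 - z) * (1 - w * z) * (1 - w ^ 2 * z) = 1 - z ^ 3" for z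
    using cube_root_prod[OF w, of 1 "- z"] by simp
  have f1: "(1 - y * t) * (1 - w * y * t) * (1 - w ^ 2 * y * t) = 1 - y ^ 3 * t ^ 3"
    using f[of "y * t"] by (simp add: power_mult_distrib ac_simps)
  \<comment> \<open>Squaring exchanges w and w^2, so the squared arguments yield the same three
    factors in another order.\<close>
  have "(1 - y ^ 2 * t) * (1 - w * (y ^ 2 * t)) * (1 - w ^ 2 * (y ^ 2 * t)) = 1 - (y ^ 3) ^ 2 * t ^ 3"
    using f[of "y ^ 2 * t"] by (simp add: power_mult_distrib flip: power_mult)
  then have f2: "(1 - y ^ 2 * t) * (1 - (w * y) ^ 2 * t) * (1 - (w ^ 2 * y) ^ 2 * t) = 1 - (y ^ 3) ^ 2 * t ^ 3"
    unfolding power_mult_distrib cube_root_square(1)[OF w] by (simp only: ac_simps)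
  have f3: "1 - (w * y) ^ 3 * t = 1 - y ^ 3 * t" "1 - (w ^ 2 * y) ^ 3 * t = 1 - y ^ 3 * t"
    unfolding power_mult_distrib w3 w23 by simp_all
  have "P y (3 * Suc m) * P (w * y) (3 * Suc m) * P (w ^ 2 * y) (3 * Suc m) * P (y ^ 9) (Suc m)
     = (P y (3 * m) * P (w * y) (3 * m) * P (w ^ 2 * y) (3 * m) * P (y ^ 9) m)
       * (((1 - y * t) * (1 - w * y * t) * (1 - w ^ 2 * y * t))
       * ((1 - y ^ 2 * t) * (1 - (w * y) ^ 2 * t) * (1 - (w ^ 2 * y) ^ 2 * t))
       * ((1 - y ^ 3 * t) * (1 - (w * y) ^ 3 * t) * (1 - (w ^ 2 * y) ^ 3 * t)) * (1 - y ^ 9 * t ^ 3))"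
  proof -
    have "P (y ^ 9) (Suc m) = P (y ^ 9) m * (1 - y ^ 9 * t ^ 3)"
      using t by (simp add: P_def)
    then show ?thesis
      unfolding P3 t t_def[symmetric] by (simp only: ac_simps)
  qed
  also have "\<dots> = P (y ^ 3) (3 * m) * P (y ^ 3) m ^ 3
      * ((1 - y ^ 3 * t ^ 3) * (1 - (y ^ 3) ^ 2 * t ^ 3) * (1 - y ^ 3 * t) ^ 3 * (1 - y ^ 9 * t ^ 3))"
    unfolding Suc f1 f2 f3 by (simp only: power3_eq_cube ac_simps)
  also have "\<dots> = P (y ^ 3) (3 * Suc m) * P (y ^ 3) (Suc m) ^ 3"
  proof -
    have "P (y ^ 3) (Suc m) = P (y ^ 3) m * (1 - y ^ 3 * t)"
      using t by (simp add: P_def)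
    moreover have "y ^ 9 = (y ^ 3) ^ 3"
      by (simp flip: power_mult)
    ultimately show ?thesis
      unfolding P3 t by (simp only: power_mult_distrib ac_simps)
  qed
  finally show ?case .
qed

lemma qpoch_norm:
  fixes w y :: "complex fps"
  assumes w: "w ^ 2 + w + 1 = 0" and y: "y $ 0 = 0"
  shows "qpoch_inf y y * qpoch_inf (w * y) (w * y) * qpoch_inf (w ^ 2 * y) (w ^ 2 * y) * qpoch_inf (y ^ 9) (y ^ 9)
       = qpoch_inf (y ^ 3) (y ^ 3) ^ 4"
proof -
  have lim: "(\<lambda>m. \<Prod>k<m. 1 - x * x ^ k) \<longlonglongrightarrow> qpoch_inf x x" if "x $ 0 = 0" for x :: "complex fps"
    by (rule tendsto_qpoch[OF that that])
  have "filterlim (\<lambda>m::nat. 3 * m) at_top sequentially"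
    by (rule filterlim_at_top_mono[OF filterlim_ident]) simp
  then have lim3: "(\<lambda>m. \<Prod>k<3 * m. 1 - x * x ^ k) \<longlonglongrightarrow> qpoch_inf x x" if "x $ 0 = 0" for x :: "complex fps"
    by (rule filterlim_compose[OF lim[OF that]])
  note L = LIMSEQ_unique[OF
      tendsto_mult_fps[OF tendsto_mult_fps[OF tendsto_mult_fps[OF lim3[of y] lim3[of "w * y"]] lim3[of "w ^ 2 * y"]] lim[of "y ^ 9"],
        unfolded finite_qpoch_norm[OF w]]
      tendsto_mult_fps[OF lim3[of "y ^ 3"] tendsto_power_fps[OF lim[of "y ^ 3"], of 3]]]
  have "qpoch_inf y y * qpoch_inf (w * y) (w * y) * qpoch_inf (w ^ 2 * y) (w ^ 2 * y) * qpoch_inf (y ^ 9) (y ^ 9)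
       = qpoch_inf (y ^ 3) (y ^ 3) * qpoch_inf (y ^ 3) (y ^ 3) ^ 3"
    by (rule L) (use y in \<open>simp_all add: fps_power_zeroth\<close>)
  then show ?thesis
    by (simp add: eval_nat_numeral)
qed

text \<open>The dissection of \<open>eta 1 * eta 2\<close> is multiplied over q -> c q for c = 1, w,
  w^2. On the left \<open>qpoch_norm\<close> evaluates the product; on the right each linear factor
  turns into a sum of cubes.\<close>

lemma eta_1_eta_2_norm:
  defines "u \<equiv> eta 6 * eta 9 ^ 3" and "v \<equiv> eta 3 * eta 18 ^ 3"
  shows "eta 3 ^ 4 * eta 6 ^ 4 * (eta 3 * eta 6 * eta 9 ^ 2 * eta 18 ^ 2) ^ 3
       = eta 9 * eta 18 * ((u ^ 3 - 8 * fps_X ^ 3 * v ^ 3) * (u ^ 3 + fps_X ^ 3 * v ^ 3))"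
proof -
  define w :: "complex fps" where "w = fps_const (Complex (- 1 / 2) (sqrt 3 / 2))"
  have "(Complex (- 1 / 2) (sqrt 3 / 2)) ^ 2 + Complex (- 1 / 2) (sqrt 3 / 2) + 1 = 0"
    by (simp add: complex_eq_iff power2_eq_square)
  then have w: "w ^ 2 + w + 1 = 0"
    unfolding w_def fps_const_power fps_const_add fps_const_1_eq_1[symmetric] by simp
  note w3 = cube_root_pow_3[OF w]
  have w23: "(w ^ 2) ^ 3 = 1"
    using w3 by (metis mult.commute power_mult power_one)
  define D where "D = eta 3 * eta 6 * eta 9 ^ 2 * eta 18 ^ 2"
  \<comment> \<open>Series in q^3 such as \<open>u\<close>, \<open>v\<close> and \<open>D\<close>
    are fixed by these substitutions.\<close>
  have inv: "eta (3 * k) oo c * fps_X = eta (3 * k)" if "c ^ 3 = 1" "k > 0" for c k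
  proof -
    have "(c * fps_X) ^ (3 * k) = fps_X ^ (3 * k)"
      using that(1) by (simp add: power_mult_distrib power_mult)
    then show ?thesis
      using that(2) by (subst eta_compose) (simp_all add: eta_def)
  qed
  have E: "qpoch_inf (c * fps_X) (c * fps_X) * qpoch_inf ((c * fps_X) ^ 2) ((c * fps_X) ^ 2) * D
      = (u + c * (- 2 * fps_X * v)) * (u + c * (fps_X * v))" if "c ^ 3 = 1" for c
  proof -
    define h where "h = c * fps_X"
    have h: "h $ 0 = 0"
      by (simp add: h_def)
    have inv': "eta k oo h = eta k" if "k \<in> {3, 6, 9, 18}" for k
      using inv[OF \<open>c ^ 3 = 1\<close>, of "k div 3"] that by (auto simp: h_def)
    have "(eta 1 oo h) * (eta 2 oo h) * D = (u - 2 * h * v) * (u + h * v)"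
      using arg_cong[OF eta_1_eta_2_trisection, of "\<lambda>f. f oo h"] h
      by (simp add: fps_compose_mult_distrib fps_compose_add_distrib fps_compose_sub_distrib
           inv' fps_compose_power[symmetric] D_def u_def v_def)
    then have "qpoch_inf h h * qpoch_inf (h ^ 2) (h ^ 2) * D = (u - 2 * h * v) * (u + h * v)"
      using eta_compose[of 1 h] eta_compose[of 2 h] h by simp
    then show ?thesis
      by (simp add: h_def ac_simps)
  qed
  have N1: "qpoch_inf (1 * fps_X) (1 * fps_X) * qpoch_inf (w * fps_X) (w * fps_X) * qpoch_inf (w ^ 2 * fps_X) (w ^ 2 * fps_X) * eta 9 = eta 3 ^ 4"
    using qpoch_norm[OF w, of fps_X] by (simp add: eta_def)
  \<comment> \<open>For q^2 the root w acts as w^2, so the norm is taken with \<open>w ^ 2\<close>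
    in place of \<open>w\<close>.\<close>
  have N2: "qpoch_inf ((1 * fps_X) ^ 2) ((1 * fps_X) ^ 2) * qpoch_inf ((w * fps_X) ^ 2) ((w * fps_X) ^ 2)
     * qpoch_inf ((w ^ 2 * fps_X) ^ 2) ((w ^ 2 * fps_X) ^ 2) * eta 18 = eta 6 ^ 4"
    using qpoch_norm[OF cube_root_square(2)[OF w], of "fps_X ^ 2"]
    by (simp add: eta_def power_mult_distrib flip: power_mult)
  have "eta 3 ^ 4 * eta 6 ^ 4 * D ^ 3 = eta 9 * eta 18 *
     ((qpoch_inf (1 * fps_X) (1 * fps_X) * qpoch_inf ((1 * fps_X) ^ 2) ((1 * fps_X) ^ 2) * D)
    * (qpoch_inf (w * fps_X) (w * fps_X) * qpoch_inf ((w * fps_X) ^ 2) ((w * fps_X) ^ 2) * D)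
    * (qpoch_inf (w ^ 2 * fps_X) (w ^ 2 * fps_X) * qpoch_inf ((w ^ 2 * fps_X) ^ 2) ((w ^ 2 * fps_X) ^ 2) * D))"
    unfolding N1[symmetric] N2[symmetric] by (simp only: power3_eq_cube ac_simps)
  also have "\<dots> = eta 9 * eta 18 *
     (((u + 1 * (- 2 * fps_X * v)) * (u + w * (- 2 * fps_X * v)) * (u + w ^ 2 * (- 2 * fps_X * v)))
    * ((u + 1 * (fps_X * v)) * (u + w * (fps_X * v)) * (u + w ^ 2 * (fps_X * v))))"
    unfolding E[of 1, OF power_one] E[OF w3] E[OF w23] by (simp only: ac_simps)
  also have "\<dots> = eta 9 * eta 18 * ((u ^ 3 - 8 * fps_X ^ 3 * v ^ 3) * (u ^ 3 + fps_X ^ 3 * v ^ 3))"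
    unfolding mult_1 cube_root_prod[OF w] by (simp add: power_mult_distrib)
  finally show ?thesis
    by (simp add: D_def)
qed

section \<open>Extraction of the exponents 3n + 1\<close>

definition section_1 :: "complex fps \<Rightarrow> complex fps" where
  "section_1 f = Abs_fps (\<lambda>n. f $ (3 * n + 1))"

lemma section_1_nth [simp]: "section_1 f $ n = f $ (3 * n + 1)"
  by (simp add: section_1_def)

text \<open>A series in q^3 does not shift exponents modulo 3, so it passes through the
  extraction.\<close>

lemma section_1_mult_compose: "section_1 (f * (g oo fps_X ^ 3)) = section_1 f * g"
proof (rule fps_ext)
  fix n
  have "section_1 (f * (g oo fps_X ^ 3)) $ n = (\<Sum>i=0..3 * n + 1. (g oo fps_X ^ 3) $ i * f $ (3 * n + 1 - i))"
    by (simp add: mult.commute[of f] fps_mult_nth)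
  also have "\<dots> = (\<Sum>i\<in>(\<lambda>j. 3 * j) ` {0..n}. (g oo fps_X ^ 3) $ i * f $ (3 * n + 1 - i))"
    by (rule sum.mono_neutral_right) (auto simp: fps_nth_compose_X_power elim!: dvdE)
  also have "\<dots> = (\<Sum>j=0..n. g $ j * f $ (3 * (n - j) + 1))"
    by (subst sum.reindex) (auto simp: inj_on_def fps_nth_compose_X_power diff_mult_distrib2 Suc_diff_le intro!: sum.cong)
  also have "\<dots> = (section_1 f * g) $ n"
    by (simp add: mult.commute[of _ g] fps_mult_nth)
  finally show "section_1 (f * (g oo fps_X ^ 3)) $ n = (section_1 f * g) $ n" .
qed

lemma section_1_compose_components:
  "section_1 ((f oo fps_X ^ 3) + fps_X * (g oo fps_X ^ 3) + fps_X ^ 2 * (h oo fps_X ^ 3)) = g"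
proof (rule fps_ext)
  fix n :: nat
  have "\<not> 3 dvd 3 * n + 1" "3 * n + 1 \<ge> 2 \<Longrightarrow> \<not> 3 dvd 3 * n + 1 - 2"
    by presburger+
  then show "section_1 ((f oo fps_X ^ 3) + fps_X * (g oo fps_X ^ 3) + fps_X ^ 2 * (h oo fps_X ^ 3)) $ n = g $ n"
    by (auto simp: fps_X_power_mult_nth fps_nth_compose_X_power)
qed

text \<open>The norm makes \<open>G\<close> equal to the polynomial \<open>R\<close> over a series
  in q^3. Only the part of \<open>R\<close> with exponents 1 modulo 3 is then needed.\<close>

lemma section_1_eta_quotient:
  assumes "G * eta 1 * eta 2 * eta 3 = eta 6"
  shows "section_1 G * (eta 1 ^ 7 * eta 2 ^ 5 * eta 3 ^ 3 * eta 6 ^ 3)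
       = eta 1 * eta 2 ^ 3 * eta 3 ^ 9 * eta 6 ^ 3 + 4 * fps_X * eta 1 ^ 4 * eta 6 ^ 12"
proof -
  define u v where "u = eta 6 * eta 9 ^ 3" and "v = eta 3 * eta 18 ^ 3"
  define u' v' where "u' = eta 2 * eta 3 ^ 3" and "v' = eta 1 * eta 6 ^ 3"
  define D where "D = eta 3 * eta 6 * eta 9 ^ 2 * eta 18 ^ 2"
  \<comment> \<open>The cofactor of (u - 2 q v) (u + q v) in (u^3 - 8 q^3 v^3) (u^3 + q^3
    v^3).\<close>
  define R where "R = (u ^ 2 + 2 * fps_X * u * v + 4 * fps_X ^ 2 * v ^ 2) * (u ^ 2 - fps_X * u * v + fps_X ^ 2 * v ^ 2)"
  have tri: "eta 1 * eta 2 * D = (u - 2 * fps_X * v) * (u + fps_X * v)"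
    using eta_1_eta_2_trisection by (simp add: D_def u_def v_def)
  have norm: "eta 3 ^ 4 * eta 6 ^ 4 * D ^ 3 = eta 9 * eta 18 * ((u ^ 3 - 8 * fps_X ^ 3 * v ^ 3) * (u ^ 3 + fps_X ^ 3 * v ^ 3))"
    using eta_1_eta_2_norm by (simp add: D_def u_def v_def)
  have "(u ^ 3 - 8 * fps_X ^ 3 * v ^ 3) * (u ^ 3 + fps_X ^ 3 * v ^ 3) = (u - 2 * fps_X * v) * (u + fps_X * v) * R"
  proof -
    have "u ^ 3 - 8 * fps_X ^ 3 * v ^ 3 = (u - 2 * fps_X * v) * (u ^ 2 + 2 * fps_X * u * v + 4 * fps_X ^ 2 * v ^ 2)"
      "u ^ 3 + fps_X ^ 3 * v ^ 3 = (u + fps_X * v) * (u ^ 2 - fps_X * u * v + fps_X ^ 2 * v ^ 2)"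
      by (simp_all add: power2_eq_square power3_eq_cube algebra_simps)
    then show ?thesis
      by (simp only: R_def ac_simps)
  qed
  then have norm': "eta 3 ^ 4 * eta 6 ^ 4 * D ^ 3 = eta 9 * eta 18 * (eta 1 * eta 2 * D * R)"
    unfolding norm tri by simp
  have D: "D \<noteq> 0" "D = eta 3 * eta 6 * eta 9 ^ 2 * eta 18 ^ 2"
    by (simp_all add: D_def eta_neq_0)
  have "(G * (eta 3 ^ 5 * eta 6 ^ 3 * D ^ 2)) * (eta 6 * D) = G * eta 3 * (eta 3 ^ 4 * eta 6 ^ 4 * D ^ 3)"
    by (simp add: eval_nat_numeral)
  also have "\<dots> = (G * eta 1 * eta 2 * eta 3) * (eta 9 * eta 18 * D * R)"
    unfolding norm' by (simp only: ac_simps)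
  also have "\<dots> = (eta 9 * eta 18 * R) * (eta 6 * D)"
    unfolding assms by (simp only: ac_simps)
  finally have "G * (eta 3 ^ 5 * eta 6 ^ 3 * D ^ 2) = eta 9 * eta 18 * R"
    using D(1) eta_neq_0[of 6] by simp
  then have "(G * (eta 3 ^ 7 * eta 6 ^ 5 * eta 9 ^ 3 * eta 18 ^ 3)) * (eta 9 * eta 18) = R * (eta 9 * eta 18)"
    unfolding D(2) by (simp add: eval_nat_numeral ac_simps)
  then have GR: "G * (eta 3 ^ 7 * eta 6 ^ 5 * eta 9 ^ 3 * eta 18 ^ 3) = R"
    using eta_neq_0[of 9] eta_neq_0[of 18] by simp
  note comp = fps_compose_mult_distrib fps_compose_add_distrib fps_compose_sub_distrib
    fps_compose_power[symmetric] eta_compose_X_power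
  have c1: "(eta 1 ^ 7 * eta 2 ^ 5 * eta 3 ^ 3 * eta 6 ^ 3) oo fps_X ^ 3 = eta 3 ^ 7 * eta 6 ^ 5 * eta 9 ^ 3 * eta 18 ^ 3"
    by (simp add: comp)
  have uv: "u = u' oo fps_X ^ 3" "v = v' oo fps_X ^ 3"
    by (simp_all add: u_def v_def u'_def v'_def comp)
  have "(u' ^ 4 - 2 * fps_X * u' * v' ^ 3) oo fps_X ^ 3 = u ^ 4 - 2 * fps_X ^ 3 * u * v ^ 3"
    "(u' ^ 3 * v' + 4 * fps_X * v' ^ 4) oo fps_X ^ 3 = u ^ 3 * v + 4 * fps_X ^ 3 * v ^ 4"
    "(3 * u' ^ 2 * v' ^ 2) oo fps_X ^ 3 = 3 * u ^ 2 * v ^ 2"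
    by (simp_all add: comp uv)
  \<comment> \<open>Expanded, R = u^4 + q u^3 v + 3 q^2 u^2 v^2 - 2 q^3 u v^3 + 4 q^4 v^4, sorted by
    the exponent of q modulo 3.\<close>
  then have "R = ((u' ^ 4 - 2 * fps_X * u' * v' ^ 3) oo fps_X ^ 3)
     + fps_X * ((u' ^ 3 * v' + 4 * fps_X * v' ^ 4) oo fps_X ^ 3)
     + fps_X ^ 2 * ((3 * u' ^ 2 * v' ^ 2) oo fps_X ^ 3)"
    by (simp only:) (simp add: R_def algebra_simps eval_nat_numeral)
  then have "section_1 R = u' ^ 3 * v' + 4 * fps_X * v' ^ 4"
    by (simp only: section_1_compose_components)
  moreover have "section_1 R = section_1 G * (eta 1 ^ 7 * eta 2 ^ 5 * eta 3 ^ 3 * eta 6 ^ 3)"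
    unfolding GR[symmetric] c1[symmetric] by (rule section_1_mult_compose)
  ultimately show ?thesis
    by (simp add: u'_def v'_def power_mult_distrib ac_simps flip: power_mult)
qed

section \<open>The generating function\<close>

definition bounded_partitions :: "nat \<Rightarrow> nat \<Rightarrow> nat multiset set" where
  "bounded_partitions N n = {M. set_mset M \<subseteq> {1..N} \<and> sum_mset M = n}"

text \<open>For a partition this is the number of its designations.\<close>

definition count_prod :: "'a multiset \<Rightarrow> nat" where
  "count_prod M = (\<Prod>t\<in>set_mset M. count M t)"

lemma finite_bounded_partitions: "finite (bounded_partitions N n)"
proof (rule finite_subset)
  show "bounded_partitions N n \<subseteq> fst ` designated_partitions n"
  proof
    fix M assume "M \<in> bounded_partitions N n"
    \<comment> \<open>Designating the first copy of every size shows that each such partition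
      underlies some object.\<close>
    then have "(M, \<lambda>t\<in>set_mset M. 1) \<in> designated_partitions n"
      by (auto simp: bounded_partitions_def designated_partitions_def)
    then show "M \<in> fst ` designated_partitions n"
      by force
  qed
qed (simp add: finite_designated_partitions)

lemma PD_eq_sum:
  assumes "n \<le> N"
  shows "PD n = (\<Sum>M\<in>bounded_partitions N n. count_prod M)"
proof -
  have "t \<le> sum_mset M" if "t \<in># M" for t :: nat and M
    using that by (auto dest!: multi_member_split)
  then have "set_mset M \<subseteq> {1..N} \<longleftrightarrow> 0 \<notin># M" if "sum_mset M = n" for M
    using that assms by (auto simp: Suc_le_eq subset_iff intro: order_trans) (metis neq0_conv)
  then have "bounded_partitions N n = {M. 0 \<notin># M \<and> sum_mset M = n}"
    unfolding bounded_partitions_def by blast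
  then have "designated_partitions n
      = (SIGMA M:bounded_partitions N n. (\<Pi>\<^sub>E t\<in>set_mset M. {1..count M t}))"
    by (auto simp: designated_partitions_def)
  then show ?thesis
    by (simp add: PD_def card_SigmaI finite_bounded_partitions finite_PiE card_PiE count_prod_def)
qed

lemma count_prod_add_replicate:
  assumes "t \<notin># M"
  shows "count_prod (M + replicate_mset c t) = (if c = 0 then 1 else c) * count_prod M"
proof (cases "c = 0")
  case False
  then have "count_prod (M + replicate_mset c t) = (\<Prod>s\<in>insert t (set_mset M). count M s + (if s = t then c else 0))"
    by (simp add: count_prod_def)
  also have "\<dots> = c * (\<Prod>s\<in>set_mset M. count M s + (if s = t then c else 0))"
    using assms by (simp add: not_in_iff)
  also have "(\<Prod>s\<in>set_mset M. count M s + (if s = t then c else 0)) = count_prod M"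
    unfolding count_prod_def using assms by (intro prod.cong) auto
  finally show ?thesis
    using False by simp
qed simp

lemma sum_count_prod_Suc:
  "(\<Sum>M\<in>bounded_partitions (Suc N) n. count_prod M)
    = (\<Sum>i\<in>{i\<in>{0..n}. Suc N dvd i}. (if i div Suc N = 0 then 1 else i div Suc N) *
        (\<Sum>M\<in>bounded_partitions N (n - i). count_prod M))"
proof -
  define t where "t = Suc N"
  have t0: "t \<noteq> 0"
    by (simp add: t_def)
  let ?I = "{i\<in>{0..n}. t dvd i}"
  have split: "filter_mset (\<lambda>s. s \<noteq> t) M + replicate_mset (count M t) t = M" for M
    by (rule multiset_eqI) simp
  have split_sum: "sum_mset (filter_mset (\<lambda>s. s \<noteq> t) M) + count M t * t = sum_mset M" for M
    using arg_cong[OF split[of M], of sum_mset] by simp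
  have notin: "t \<notin># M" if "M \<in> bounded_partitions N m" for M m
    using that by (auto simp: bounded_partitions_def t_def)
  have "(\<Sum>i\<in>?I. (if i div t = 0 then 1 else i div t) * (\<Sum>M\<in>bounded_partitions N (n - i). count_prod M))
      = (\<Sum>(i, M)\<in>(SIGMA i:?I. bounded_partitions N (n - i)). (if i div t = 0 then 1 else i div t) * count_prod M)"
    by (simp add: sum_distrib_left sum.Sigma finite_bounded_partitions)
  also have "\<dots> = (\<Sum>M\<in>bounded_partitions t n. count_prod M)"
  proof (rule sum.reindex_bij_witness[of _ "\<lambda>M. (count M t * t, filter_mset (\<lambda>s. s \<noteq> t) M)"
          "\<lambda>(i, M). M + replicate_mset (i div t) t"], goal_cases)
    case (1 p)
    then obtain i M where p: "p = (i, M)" "i \<le> n" "t dvd i" and M: "M \<in> bounded_partitions N (n - i)"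
      by (cases p) simp
    moreover have "filter_mset (\<lambda>s. s \<noteq> t) M = M"
      using notin[OF M] by (intro multiset_eqI) (auto simp: not_in_iff)
    ultimately show ?case
      using notin[OF M] by (simp add: not_in_iff)
  next
    case (2 p)
    then obtain i M where p: "p = (i, M)" "i \<le> n" "t dvd i" and M: "set_mset M \<subseteq> {1..N}" "sum_mset M = n - i"
      by (cases p) (simp add: bounded_partitions_def)
    have "set_mset (M + replicate_mset (i div t) t) \<subseteq> insert t {1..N}"
      using M(1) by (auto split: if_splits)
    also have "\<dots> = {1..t}"
      by (auto simp: t_def)
    finally show ?case
      using p M(2) by (simp add: bounded_partitions_def)
  next
    case (3 M)
    then show ?case
      using split[of M] t0 by simp
  next
    case (4 M)
    then have "set_mset (filter_mset (\<lambda>s. s \<noteq> t) M) \<subseteq> {1..N}"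
      by (auto simp: bounded_partitions_def t_def)
    with 4 show ?case
      using split_sum[of M] by (auto simp: bounded_partitions_def)
  next
    case (5 p)
    then show ?case
      using notin by (auto simp: count_prod_add_replicate)
  qed
  finally show ?thesis
    unfolding t_def ..
qed

definition designated_part_gf :: "complex fps" where
  "designated_part_gf = Abs_fps (\<lambda>c. of_nat (if c = 0 then 1 else c))"

text \<open>The series is 1 + X/(1 - X)^2 = (1 - X + X^2)/(1 - X)^2. Multiplying the numerator by (1
  + X) (1 - X^3) gives (1 + X^3) (1 - X^3).\<close>

lemma designated_part_gf_mult:
  "designated_part_gf * ((1 - fps_X) * (1 - fps_X ^ 2) * (1 - fps_X ^ 3)) = 1 - fps_X ^ 6"
proof -
  let ?K = designated_part_gf
  have "?K - 2 * (fps_X * ?K) + fps_X ^ 2 * ?K = 1 - fps_X + fps_X ^ 2"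
  proof (rule fps_ext)
    fix n
    \<comment> \<open>From n = 3 on, the left side is a second difference of the identity and
      vanishes; below, the exceptional coefficient 1 at index 0 enters.\<close>
    consider "n = 0" | "n = 1" | "n = 2" | m where "n = Suc (Suc (Suc m))"
      by (metis One_nat_def Suc_1 not0_implies_Suc)
    then show "(?K - 2 * (fps_X * ?K) + fps_X ^ 2 * ?K) $ n = (1 - fps_X + fps_X ^ 2) $ n"
      by cases (simp_all add: designated_part_gf_def fps_X_power_mult_nth numeral_fps_const fps_X_power_nth)
  qed
  then have "?K * (1 - fps_X) ^ 2 = 1 - fps_X + fps_X ^ 2"
    by (simp add: algebra_simps power2_eq_square)
  then have "(?K * (1 - fps_X) ^ 2) * ((1 + fps_X) * (1 - fps_X ^ 3)) = (1 - fps_X + fps_X ^ 2) * ((1 + fps_X) * (1 - fps_X ^ 3))"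
    by simp
  then show ?thesis
    by (simp add: algebra_simps eval_nat_numeral)
qed

definition bounded_gf :: "nat \<Rightarrow> complex fps" where
  "bounded_gf N = Abs_fps (\<lambda>n. of_nat (\<Sum>M\<in>bounded_partitions N n. count_prod M))"

lemma bounded_gf_0: "bounded_gf 0 = 1"
proof (rule fps_ext)
  fix n
  have "bounded_partitions 0 n = (if n = 0 then {{#}} else {})"
    by (auto simp: bounded_partitions_def)
  then show "bounded_gf 0 $ n = 1 $ n"
    by (simp add: bounded_gf_def count_prod_def)
qed

lemma bounded_gf_Suc: "bounded_gf (Suc N) = bounded_gf N * (designated_part_gf oo fps_X ^ Suc N)"
proof (rule fps_ext)
  fix n
  let ?K = "designated_part_gf oo fps_X ^ Suc N"
  have "(bounded_gf N * ?K) $ n = (\<Sum>i=0..n. ?K $ i * bounded_gf N $ (n - i))"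
    by (simp add: mult.commute[of "bounded_gf N"] fps_mult_nth)
  also have "\<dots> = (\<Sum>i\<in>{i\<in>{0..n}. Suc N dvd i}. ?K $ i * bounded_gf N $ (n - i))"
    by (rule sum.mono_neutral_right) (auto simp: fps_nth_compose_X_power simp del: power_Suc)
  also have "\<dots> = (\<Sum>i\<in>{i\<in>{0..n}. Suc N dvd i}. of_nat ((if i div Suc N = 0 then 1 else i div Suc N) *
        (\<Sum>M\<in>bounded_partitions N (n - i). count_prod M)))"
    by (intro sum.cong refl) (simp add: fps_nth_compose_X_power designated_part_gf_def bounded_gf_def del: power_Suc)
  finally show "bounded_gf (Suc N) $ n = (bounded_gf N * ?K) $ n"
    by (simp add: bounded_gf_def sum_count_prod_Suc del: of_nat_mult)
qed

text \<open>A part size t contributes (1 - q^(6t)) / ((1 - q^t) (1 - q^(2t)) (1 - q^(3t))), by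
  substituting q^t into \<open>designated_part_gf_mult\<close>.\<close>

lemma bounded_gf_mult:
  "bounded_gf N * (\<Prod>k<N. 1 - fps_X ^ 1 * (fps_X ^ 1) ^ k) * (\<Prod>k<N. 1 - fps_X ^ 2 * (fps_X ^ 2) ^ k)
     * (\<Prod>k<N. 1 - fps_X ^ 3 * (fps_X ^ 3) ^ k)
    = (\<Prod>k<N. 1 - fps_X ^ 6 * (fps_X ^ 6) ^ k)"
proof (induction N)
  case 0
  then show ?case
    by (simp add: bounded_gf_0)
next
  case (Suc N)
  let ?X = "fps_X ^ Suc N :: complex fps"
  have pow: "fps_X ^ j * (fps_X ^ j) ^ N = ?X ^ j" for j
    by (simp only: power_add[symmetric] power_mult[symmetric]) (simp add: algebra_simps)
  have X: "?X $ 0 = 0"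
    by simp
  have K: "(designated_part_gf oo ?X) * ((1 - ?X ^ 1) * (1 - ?X ^ 2) * (1 - ?X ^ 3)) = 1 - ?X ^ 6"
    using arg_cong[OF designated_part_gf_mult, of "\<lambda>f. f oo ?X"] X
    by (simp add: fps_compose_mult_distrib fps_compose_sub_distrib fps_compose_power[symmetric] del: power_Suc)
  show ?case
    unfolding bounded_gf_Suc prod.lessThan_Suc pow Suc[symmetric] K[symmetric] by (simp only: ac_simps)
qed

text \<open>Parts of a partition of n are at most n, so coefficient n of \<open>bounded_gf N\<close>
  is final once N >= n, and the finite product formula passes to the limit.\<close>

lemma PD_gf: "Abs_fps (\<lambda>n. of_nat (PD n)) * eta 1 * eta 2 * eta 3 = eta 6"
proof -
  have "bounded_gf \<longlonglongrightarrow> Abs_fps (\<lambda>n. of_nat (PD n))"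
  proof (rule tendsto_fpsI)
    fix n
    show "\<forall>\<^sub>F N in sequentially. bounded_gf N $ n = Abs_fps (\<lambda>n. of_nat (PD n)) $ n"
      using eventually_ge_at_top[of n] by eventually_elim (simp add: bounded_gf_def PD_eq_sum)
  qed
  moreover have "(\<lambda>N. \<Prod>k<N. 1 - fps_X ^ j * (fps_X ^ j) ^ k) \<longlonglongrightarrow> eta j" if "j > 0" for j
    unfolding eta_def using that by (intro tendsto_qpoch) simp_all
  ultimately have "(\<lambda>N. bounded_gf N * (\<Prod>k<N. 1 - fps_X ^ 1 * (fps_X ^ 1) ^ k)
     * (\<Prod>k<N. 1 - fps_X ^ 2 * (fps_X ^ 2) ^ k) * (\<Prod>k<N. 1 - fps_X ^ 3 * (fps_X ^ 3) ^ k))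
      \<longlonglongrightarrow> Abs_fps (\<lambda>n. of_nat (PD n)) * eta 1 * eta 2 * eta 3"
    by (intro tendsto_mult_fps) (simp_all del: One_nat_def power_one_right)
  moreover have "(\<lambda>N. \<Prod>k<N. 1 - fps_X ^ 6 * (fps_X ^ 6) ^ k) \<longlonglongrightarrow> eta 6"
    unfolding eta_def by (intro tendsto_qpoch) simp_all
  ultimately show ?thesis
    unfolding bounded_gf_mult by (rule LIMSEQ_unique)
qed

section \<open>Translation into q-Pochhammer symbols\<close>

theorem theorem1p6:
  fixes q :: "complex fps"
  defines "q \<equiv> fps_X"
  shows "Abs_fps (\<lambda>n. of_nat (PD (3 * n + 1))) =
      (qpoch_inf (q^3) (q^6)) ^ 3 * (qpoch_inf (q^6) (q^6)) ^ 6
        / ((qpoch_inf q (q^2)) ^ 5 * (qpoch_inf (q^2) (q^2)) ^ 8)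
      * (4 * q * ((qpoch_inf q (q^2)) ^ 2 / (qpoch_inf (q^3) (q^6)) ^ 6)
         + (qpoch_inf (q^3) (q^6)) ^ 3 / qpoch_inf q (q^2))"
proof -
  define a b where "a = qpoch_inf q (q ^ 2)" and "b = qpoch_inf (q ^ 3) (q ^ 6)"
  define H where "H = Abs_fps (\<lambda>n. of_nat (PD (3 * n + 1)) :: complex)"
  have eta: "qpoch_inf (q ^ 2) (q ^ 2) = eta 2" "qpoch_inf (q ^ 6) (q ^ 6) = eta 6"
    by (simp_all add: q_def eta_def)
  have eta1: "eta 1 = a * eta 2"
    using qpoch_odd_mult_eta[of 1] by (simp add: a_def q_def)
  have eta3: "eta 3 = b * eta 6"
    using qpoch_odd_mult_eta[of 3] by (simp add: b_def q_def)
  have unit: "a $ 0 = 1" "b $ 0 = 1" "eta 2 $ 0 = 1" "eta 6 $ 0 = 1"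
    by (simp_all add: a_def b_def q_def qpoch_nth_0 eta_nth_0)
  then have nz: "a \<noteq> 0" "b \<noteq> 0" "eta 2 \<noteq> 0" "eta 6 \<noteq> 0"
    by auto
  have "H = section_1 (Abs_fps (\<lambda>n. of_nat (PD n)))"
    by (simp add: H_def section_1_def)
  then have "H * (eta 1 ^ 7 * eta 2 ^ 5 * eta 3 ^ 3 * eta 6 ^ 3)
       = eta 1 * eta 2 ^ 3 * eta 3 ^ 9 * eta 6 ^ 3 + 4 * q * eta 1 ^ 4 * eta 6 ^ 12"
    unfolding q_def using section_1_eta_quotient[OF PD_gf] by simp
  \<comment> \<open>Substituting \<open>eta 1 = a * eta 2\<close> and
    \<open>eta 3 = b * eta 6\<close> exposes a common factor, written last on both sides.\<close>
  then have "(H * (a ^ 6 * eta 2 ^ 8 * b ^ 3)) * (a * eta 2 ^ 4 * eta 6 ^ 6)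
      = (eta 6 ^ 6 * (b ^ 9 + 4 * q * a ^ 3)) * (a * eta 2 ^ 4 * eta 6 ^ 6)"
    unfolding eta1 eta3 by (simp add: algebra_simps eval_nat_numeral)
  then have H: "H * (a ^ 6 * eta 2 ^ 8 * b ^ 3) = eta 6 ^ 6 * (b ^ 9 + 4 * q * a ^ 3)"
    using nz by simp
  \<comment> \<open>The denominators have constant term 1 and are units, so the quotients become
    products that can be compared after multiplying by
    \<open>a ^ 6 * eta 2 ^ 8 * b ^ 3\<close>.\<close>
  define A B E where "A = inverse a" and "B = inverse b" and "E = inverse (eta 2)"
  have inv: "a * A = 1" "b * B = 1" "eta 2 * E = 1"
    using unit by (simp_all add: A_def B_def E_def inverse_mult_eq_1')
  have "b ^ 3 * eta 6 ^ 6 / (a ^ 5 * eta 2 ^ 8) * (4 * q * (a ^ 2 / b ^ 6) + b ^ 3 / a)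
      = b ^ 3 * eta 6 ^ 6 * (A ^ 5 * E ^ 8) * (4 * q * (a ^ 2 * B ^ 6) + b ^ 3 * A)"
    using unit by (simp add: fps_divide_unit A_def B_def E_def fps_inverse_mult fps_inverse_power fps_power_zeroth)
  moreover have "\<dots> * (a ^ 6 * eta 2 ^ 8 * b ^ 3)
      = eta 6 ^ 6 * (a * A) ^ 5 * (eta 2 * E) ^ 8 * (4 * q * a ^ 3 * (b * B) ^ 6 + b ^ 9 * (a * A))"
    by (simp add: algebra_simps eval_nat_numeral)
  ultimately have "(b ^ 3 * eta 6 ^ 6 / (a ^ 5 * eta 2 ^ 8) * (4 * q * (a ^ 2 / b ^ 6) + b ^ 3 / a)) * (a ^ 6 * eta 2 ^ 8 * b ^ 3)
      = H * (a ^ 6 * eta 2 ^ 8 * b ^ 3)"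
    unfolding inv H by (simp add: ac_simps)
  then have "b ^ 3 * eta 6 ^ 6 / (a ^ 5 * eta 2 ^ 8) * (4 * q * (a ^ 2 / b ^ 6) + b ^ 3 / a) = H"
    using nz by simp
  then show ?thesis
    by (simp add: H_def eta a_def b_def)
qed

end
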